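(* Let $N\ge 1000$ be a real number, let $\delta>0$, and let $\mathcal{B}$ be a $\delta$-well spaced subset of $\mathbb{R}/\mathbb{Z}$. For any function $f:\mathcal{B}\to\mathbb{C}$ that is not identically zero, we have $$\sum_{p\le N}\Bigl|\sum_{b\in\mathcal{B}}f(b)e(bp)\Bigr|^2\le 280\,(N+\delta^{-1})\,\|f\|_2^2\,\frac{\log\bigl(2\|f\|_1^2/\|f\|_2^2\bigr)}{\log N}.$$
   Context: The variable $p$ denotes a prime number, and the sum over $p\le N$ runs over primes. We write $e(\alpha)=\exp(2i\pi\alpha)$, and $|y|_{\mathbb{Z}}=\min_{k\in\mathbb{Z}}|y-k|$ for the distance of $y$ to the nearest integer. A set $\mathcal{B}\subset\mathbb{R}/\mathbb{Z}$ is called $\delta$-well spaced when $|b-b'|_{\mathbb{Z}}\ge\delta$ for all distinct $b,b'\in\mathcal{B}$ (such a set is finite). For $q>0$, $\|f\|_q$ is defined by $\|f\|_q^q=\sum_{b\in\mathcal{B}}|f(b)|^q$. *)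

theory Defs
  imports Complex_Main "HOL-Computational_Algebra.Primes"
begin

definition int_dist :: "real \<Rightarrow> real" where
  "int_dist y = (INF k::int. \<bar>y - of_int k\<bar>)"

definition ee :: "real \<Rightarrow> complex" where
  "ee \<alpha> = exp (2 * \<i> * of_real pi * of_real \<alpha>)"

text \<open>The infimum defining \<^const>\<open>int_dist\<close> is attained, so it is a minimum.\<close>

lemma int_dist_le: "int_dist y \<le> \<bar>y - of_int k\<bar>"
  unfolding int_dist_def by (rule cINF_lower) (auto intro: bdd_belowI[of _ 0])

lemma int_dist_attained: "\<exists>k::int. int_dist y = \<bar>y - of_int k\<bar>"
proof -
  have "int_dist y = \<bar>y - of_int (round y)\<bar>"
  proof (rule antisym)
    show "\<bar>y - of_int (round y)\<bar> \<le> int_dist y"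
      unfolding int_dist_def
      by (rule cINF_greatest) (use round_diff_minimal[of y] in auto)
  qed (rule int_dist_le)
  then show ?thesis by blast
qed

text \<open>The group \<open>\<real>/\<int>\<close> as a quotient type.\<close>

quotient_type real_mod_int = real / "\<lambda>x y::real. x - y \<in> \<int>"
  morphisms rep_real_mod_int real_mod_int
proof (rule equivpI)
  show "reflp (\<lambda>x y::real. x - y \<in> \<int>)"
    by (auto intro: reflpI)
  show "symp (\<lambda>x y::real. x - y \<in> \<int>)"
    by (rule sympI) (metis Ints_minus minus_diff_eq)
  show "transp (\<lambda>x y::real. x - y \<in> \<int>)"
    by (rule transpI) (metis Ints_add diff_add_cancel add_diff_eq)
qed

lemma int_dist_cong:
  assumes "x - y \<in> \<int>"
  shows "int_dist x = int_dist y"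
proof -
  have le: "int_dist u \<le> int_dist v" if uv: "u - v \<in> \<int>" for u v
  proof -
    obtain m :: int where m: "u = v + of_int m"
      using uv by (metis Ints_cases add.commute diff_add_cancel)
    obtain k :: int where "int_dist v = \<bar>v - of_int k\<bar>"
      using int_dist_attained by blast
    then show ?thesis
      using int_dist_le[of u "k + m"] m by (simp add: algebra_simps)
  qed
  have "y - x \<in> \<int>"
    using assms by (metis Ints_minus minus_diff_eq)
  then show ?thesis
    using le assms by (intro antisym) auto
qed

lemma ee_cong:
  assumes "x - y \<in> \<int>"
  shows "ee x = ee y"
proof -
  obtain m :: int where m: "x = y + of_int m"
    using assms by (metis Ints_cases add.commute diff_add_cancel)
  have "ee (of_int m) = 1"
    using cis_multiple_2pi[of "of_int m"] unfolding ee_def by (simp add: cis_conv_exp mult_ac)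
  moreover have "ee (y + of_int m) = ee y * ee (of_int m)"
    unfolding ee_def by (simp add: exp_add [symmetric] algebra_simps)
  ultimately show ?thesis
    using m by simp
qed

text \<open>\<open>|b - b'|\<^sub>\<int>\<close> for \<open>b, b' \<in> \<real>/\<int>\<close>.\<close>

lift_definition circle_dist :: "real_mod_int \<Rightarrow> real_mod_int \<Rightarrow> real"
  is "\<lambda>x y. int_dist (x - y)"
proof -
  fix x x' y y' :: real
  assume "x - x' \<in> \<int>" "y - y' \<in> \<int>"
  then have "(x - x') - (y - y') \<in> \<int>" by (rule Ints_diff)
  then show "int_dist (x - y) = int_dist (x' - y')"
    by (intro int_dist_cong) (simp add: algebra_simps)
qed

text \<open>\<open>e(b n)\<close> for \<open>b \<in> \<real>/\<int>\<close>; well defined because \<open>n\<close> is an integer.\<close>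

lift_definition e_mult :: "real_mod_int \<Rightarrow> nat \<Rightarrow> complex"
  is "\<lambda>x n. ee (x * of_nat n)"
proof -
  fix x y :: real
  assume xy: "x - y \<in> \<int>"
  show "(\<lambda>n. ee (x * of_nat n)) = (\<lambda>n. ee (y * of_nat n))"
  proof
    fix n :: nat
    from xy have "(x - y) * of_nat n \<in> \<int>" by (intro Ints_mult) auto
    then show "ee (x * of_nat n) = ee (y * of_nat n)"
      by (intro ee_cong) (simp add: algebra_simps)
  qed
qed

definition well_spaced :: "real \<Rightarrow> real_mod_int set \<Rightarrow> bool" where
  "well_spaced \<delta> B \<longleftrightarrow> (\<forall>b\<in>B. \<forall>b'\<in>B. b \<noteq> b' \<longrightarrow> circle_dist b b' \<ge> \<delta>)"

text \<open>Sums over a well-spaced set are therefore genuine finite sums.\<close>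

lemma well_spaced_finite:
  assumes "\<delta> > 0" "well_spaced \<delta> B"
  shows "finite B"
proof -
  define g where "g b = \<lfloor>frac (rep_real_mod_int b) / \<delta>\<rfloor>" for b
  have "inj_on g B"
  proof (rule inj_onI, rule ccontr)
    fix b c assume bc: "b \<in> B" "c \<in> B" "g b = g c" "b \<noteq> c"
    define x where "x = rep_real_mod_int b"
    define y where "y = rep_real_mod_int c"
    have bx: "b = real_mod_int x" and cy: "c = real_mod_int y"
      unfolding x_def y_def
      by (simp_all add: Quotient3_abs_rep[OF Quotient3_real_mod_int])
    have "\<delta> \<le> circle_dist b c"
      using assms bc by (auto simp: well_spaced_def)
    also have "\<dots> = int_dist (x - y)"
      unfolding bx cy by (simp add: circle_dist.abs_eq)
    also have "\<dots> \<le> \<bar>frac x - frac y\<bar>"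
      using int_dist_le[of "x - y" "\<lfloor>x\<rfloor> - \<lfloor>y\<rfloor>"] by (simp add: frac_def algebra_simps)
    finally have "\<delta> \<le> \<bar>frac x - frac y\<bar>" .
    moreover have "\<bar>frac x / \<delta> - frac y / \<delta>\<bar> < 1"
      using bc(3) unfolding g_def x_def[symmetric] y_def[symmetric] by linarith
    then have "\<bar>frac x - frac y\<bar> / \<delta> < 1"
      using assms(1) by (simp add: diff_divide_distrib [symmetric])
    ultimately show False
      using assms(1) by (simp add: field_simps)
  qed
  moreover have "g ` B \<subseteq> {0..\<lfloor>1 / \<delta>\<rfloor>}"
  proof
    fix z assume "z \<in> g ` B"
    then obtain b where z: "z = g b" by auto
    have "0 \<le> frac (rep_real_mod_int b) / \<delta>" "frac (rep_real_mod_int b) / \<delta> \<le> 1 / \<delta>"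
      using assms(1) frac_lt_1[of "rep_real_mod_int b"]
      by (auto intro!: divide_right_mono)
    then show "z \<in> {0..\<lfloor>1 / \<delta>\<rfloor>}"
      unfolding z g_def by (auto intro: floor_mono)
  qed
  ultimately show ?thesis
    by (meson finite_atLeastAtMost_int finite_imageD finite_subset)
qed

definition lnorm :: "real \<Rightarrow> real_mod_int set \<Rightarrow> (real_mod_int \<Rightarrow> complex) \<Rightarrow> real" where
  "lnorm q B f = (\<Sum>b\<in>B. norm (f b) powr q) powr (1 / q)"

end

theory Submission
  imports Defs "HOL-Analysis.Analysis"
begin

text \<open>
  Write \<open>M = N + 1/\<delta>\<close>, \<open>S(n) = \<Sum>\<^sub>b f(b) e(bn)\<close> and \<open>K = \<parallel>f\<parallel>\<^sub>1\<^sup>2 / \<parallel>f\<parallel>\<^sub>2\<^sup>2 \<ge> 1\<close>.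
  The plain large sieve bounds the sum of \<open>|S(n)|\<^sup>2\<close> over all integers \<open>n \<le> N\<close> by a constant times
  \<open>M \<parallel>f\<parallel>\<^sub>2\<^sup>2\<close>.  Restricting to primes ought to save a factor \<open>log N\<close>, which an upper bound sieve
  provides; but a sieve weight has frequencies at all fractions \<open>a/q\<close>, and the shifted points
  \<open>b + a/q\<close> may come close to one another, so that the large sieve no longer applies to them.

  The way out is to sieve only by the primes in \<open>(w, z]\<close>, with \<open>z = N\<^bsup>1/4\<^esup>\<close> and
  \<open>w = (2K)\<^sup>6\<close>.  The weight used is the square \<open>|h(n)|\<^sup>2 / G\<^sup>2\<close>, where \<open>h\<close> combines the additive
  characters \<open>e(na/q)\<close> with coefficients \<open>\<mu>(q)/\<phi>(q)\<close> over squarefree \<open>q \<le> z\<close> composed of sieving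
  primes and \<open>G = \<Sum> 1/\<phi>(q)\<close>; it equals 1 at every integer free of sieving primes.  Expanding the
  square, the frequency 0 has coefficient \<open>1/G\<close>, and the large sieve turns it into
  \<open>2 M \<parallel>f\<parallel>\<^sub>2\<^sup>2 / G\<close>.  Any other frequency has a denominator divisible by a prime \<open>p > w\<close>, and its
  coefficient is at most \<open>3 / ((p - 1) G)\<close> (lemma \<open>sum_weight_products_le\<close>).  These frequencies are
  \<open>z\<^bsup>-4\<^esup>\<close>-spaced, so together they contribute \<open>O(M \<parallel>f\<parallel>\<^sub>1\<^sup>2 / (w G))\<close>, which
  is \<open>O(M \<parallel>f\<parallel>\<^sub>2\<^sup>2 / G)\<close> because \<open>w\<close> exceeds \<open>K\<close>.  This is lemma \<open>sieved_large_sieve\<close>.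

  It remains to see that \<open>G\<close> is of size \<open>log z / log w\<close>, that is, of size \<open>log N / log (2K)\<close>.
  Adding the primes up to \<open>w\<close> back multiplies \<open>G\<close> by at most \<open>\<Prod>\<^bsub>p \<le> w\<^esub> p/(p-1)\<close> and produces
  at least \<open>\<Sum>\<^bsub>n \<le> z\<^esub> 1/n\<close> (lemma \<open>ln_le_prod_times_sieve_sum\<close>), and the product is
  \<open>O(log w)\<close> by Mertens (lemma \<open>mertens_product_le\<close>).  Primes below \<open>z\<close> are negligible when \<open>K\<close> is a
  small power of \<open>N\<close>; for larger \<open>K\<close> the plain large sieve is already good enough.
\<close>

section \<open>The Mertens sum over primes\<close>

lemma finite_primes_le [simp]: "finite {p::nat. prime p \<and> real p \<le> x}"
proof (rule finite_subset)
  show "{p::nat. prime p \<and> real p \<le> x} \<subseteq> {..nat \<lfloor>x\<rfloor>}"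
    by (auto simp: le_nat_floor)
qed simp

lemma prod_primes_dvd:
  fixes n :: nat
  assumes "finite A" "\<And>p. p \<in> A \<Longrightarrow> prime p" "\<And>p. p \<in> A \<Longrightarrow> p dvd n"
  shows "(\<Prod>p\<in>A. p) dvd n"
  using assms
proof (induction A rule: finite_induct)
  case (insert q A)
  have "coprime q (\<Prod>p\<in>A. p)"
    using insert by (intro prod_coprime_right) (metis insertI1 insertI2 primes_coprime)
  then show ?case using insert by (simp add: divides_mult)
qed simp

text \<open>
  The binomial coefficient occurs twice in row \<open>2m + 1\<close>, whose entries add up to \<open>2\<^bsup>2m+1\<^esup>\<close>.
\<close>

lemma central_binomial_odd_le: "(2 * m + 1) choose m \<le> 4 ^ m"
proof -
  have "2 * ((2 * m + 1) choose m) = ((2 * m + 1) choose m) + ((2 * m + 1) choose (m + 1))"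
    using binomial_symmetric[of m "2 * m + 1"] by simp
  also have "\<dots> = (\<Sum>k\<in>{m, m + 1}. (2 * m + 1) choose k)"
    by simp
  also have "\<dots> \<le> (\<Sum>k\<le>2 * m + 1. (2 * m + 1) choose k)"
    by (intro sum_mono2) auto
  also have "\<dots> = 2 * 4 ^ m"
    using choose_row_sum[of "2 * m + 1"] by (simp add: power_mult)
  finally show ?thesis by simp
qed

text \<open>
  Chebyshev's bound, by Erdos's argument: every prime in \<open>(m + 1, 2m + 1]\<close> divides \<open>2m + 1 choose m\<close>,
  which is at most \<open>4\<^sup>m\<close>, and induction handles the primes up to \<open>m + 1\<close>.
\<close>

lemma prod_primes_le_four_power: "(\<Prod>p | prime p \<and> p \<le> n. p) \<le> (4::nat) ^ n"
proof (induction n rule: less_induct)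
  case (less n)
  consider "n \<le> 1" | "n = 2" | "n > 2" "even n" | m where "n = 2 * m + 1" "m \<ge> 1"
  proof -
    have "n \<le> 1 \<or> n = 2 \<or> (n > 2 \<and> even n) \<or> (\<exists>m\<ge>1. n = 2 * m + 1)"
    proof (cases "even n")
      case False
      then obtain m where "n = 2 * m + 1" by (auto elim: oddE)
      then show ?thesis by (cases m) auto
    qed linarith
    then show ?thesis using that by blast
  qed
  then show ?case
  proof cases
    case 1
    then have "{p. prime p \<and> p \<le> n} = {}"
      by (auto dest!: prime_ge_2_nat)
    then show ?thesis by (simp only: prod.empty) simp
  next
    case 2
    have "prime p \<and> p \<le> n \<longleftrightarrow> p = 2" for p
      using 2 prime_ge_2_nat[of p] two_is_prime_nat by auto
    then have "{p. prime p \<and> p \<le> n} = {2}" by auto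
    then show ?thesis using 2 by (simp only:) simp
  next
    case 3
    then have "\<not> prime n" using prime_odd_nat[of n] by auto
    then have "p \<le> n \<longleftrightarrow> p \<le> n - 1" if "prime p" for p
      using that 3 by (cases "p = n") auto
    then have "{p. prime p \<and> p \<le> n} = {p. prime p \<and> p \<le> n - 1}" by auto
    then have "(\<Prod>p | prime p \<and> p \<le> n. p) \<le> 4 ^ (n - 1)"
      using less.IH[of "n - 1"] 3 by simp
    also have "\<dots> \<le> 4 ^ n" by (intro power_increasing) auto
    finally show ?thesis .
  next
    case 4
    let ?A = "{p. prime p \<and> p \<le> m + 1}" and ?B = "{p. prime p \<and> m + 1 < p \<and> p \<le> n}"
    have split: "{p. prime p \<and> p \<le> n} = ?A \<union> ?B" using 4 by auto
    have fin: "finite ?A" "finite ?B" by auto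
    have "p dvd n choose m" if "p \<in> ?B" for p
    proof -
      from that have p: "prime p" "m + 1 < p" "p \<le> n" by auto
      have "p dvd fact n" using p by (simp add: prime_dvd_fact_iff)
      moreover have "fact n = fact m * fact (n - m) * (n choose m)"
        using binomial_fact_lemma[of m n] 4 by simp
      ultimately have "p dvd fact m * fact (n - m) * (n choose m)" by simp
      moreover have "\<not> p dvd fact m" "\<not> p dvd fact (n - m)"
        using p 4 prime_dvd_fact_iff[OF p(1), of m] prime_dvd_fact_iff[OF p(1), of "n - m"]
        by auto
      ultimately show ?thesis using p(1) by (simp add: prime_dvd_mult_iff)
    qed
    then have "(\<Prod>p\<in>?B. p) dvd (n choose m)"
      using fin by (intro prod_primes_dvd) auto
    moreover have "0 < n choose m" using 4 by simp
    ultimately have "(\<Prod>p\<in>?B. p) \<le> n choose m" by (rule dvd_imp_le)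
    also have "\<dots> \<le> 4 ^ m" unfolding 4(1) by (rule central_binomial_odd_le)
    finally have B: "(\<Prod>p\<in>?B. p) \<le> 4 ^ m" .
    have "(\<Prod>p | prime p \<and> p \<le> n. p) = (\<Prod>p\<in>?A. p) * (\<Prod>p\<in>?B. p)"
      unfolding split by (intro prod.union_disjoint fin) auto
    also have "\<dots> \<le> 4 ^ (m + 1) * 4 ^ m"
      using less.IH[of "m + 1"] 4 B by (intro mult_mono) auto
    also have "\<dots> = 4 ^ (m + 1 + m)" by (rule power_add [symmetric])
    also have "m + 1 + m = n" using 4(1) by simp
    finally show ?thesis .
  qed
qed

lemma sum_ln_primes_le: "(\<Sum>p | prime p \<and> p \<le> n. ln (real p)) \<le> real n * ln 4"
proof -
  have "(\<Sum>p | prime p \<and> p \<le> n. ln (real p)) = ln (\<Prod>p | prime p \<and> p \<le> n. real p)"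
    by (rule ln_prod [symmetric]) (auto dest: prime_gt_0_nat)
  also have "\<dots> \<le> ln (4 ^ n)"
  proof -
    have "real (\<Prod>p | prime p \<and> p \<le> n. p) \<le> real (4 ^ n)"
      using prod_primes_le_four_power[of n] of_nat_mono by blast
    moreover have "0 < (\<Prod>p | prime p \<and> p \<le> n. real p)"
      by (intro prod_pos) (auto dest: prime_gt_0_nat)
    ultimately show ?thesis by simp
  qed
  finally show ?thesis by (simp add: ln_realpow)
qed

text \<open>
  The product of the distinct primes dividing \<open>m\<close> divides \<open>m\<close>.
\<close>

lemma sum_ln_prime_divisors_le:
  assumes "m > 0"
  shows "(\<Sum>p | prime p \<and> p dvd m. ln (real p)) \<le> ln (real m)"
proof -
  let ?P = "{p. prime p \<and> p dvd m}"
  have fin: "finite ?P"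
    using assms by (intro finite_subset[of ?P "{..m}"]) (auto dest: dvd_imp_le)
  have "(\<Prod>p\<in>?P. p) dvd m"
    using fin by (intro prod_primes_dvd) auto
  then have le: "(\<Prod>p\<in>?P. p) \<le> m" using assms by (rule dvd_imp_le)
  have "(\<Sum>p\<in>?P. ln (real p)) = ln (\<Prod>p\<in>?P. real p)"
    using fin by (intro ln_prod [symmetric]) (auto dest: prime_gt_0_nat)
  also have "\<dots> = ln (real (\<Prod>p\<in>?P. p))" by simp
  also have "\<dots> \<le> ln (real m)"
  proof -
    have "0 < (\<Prod>p\<in>?P. p)" by (intro prod_pos) (auto dest: prime_gt_0_nat)
    then show ?thesis using le by (subst ln_le_cancel_iff) linarith+
  qed
  finally show ?thesis .
qed

lemma card_multiples: "p > 0 \<Longrightarrow> card {m\<in>{1..n}. p dvd m} = n div (p::nat)"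
proof -
  assume p: "p > 0"
  have "{m\<in>{1..n}. p dvd m} = (\<lambda>k. p * k) ` {1..n div p}"
    using p by (auto simp: less_eq_div_iff_mult_less_eq mult_ac dvd_def image_iff)
  moreover have "inj_on (\<lambda>k. p * k) {1..n div p}" using p by (auto intro: inj_onI)
  ultimately show ?thesis by (simp add: card_image)
qed

text \<open>
  Half of Mertens' first theorem.  Counting the pairs \<open>p dvd m \<le> n\<close> with weight \<open>log p\<close> gives
  \<open>\<Sum> \<lfloor>n/p\<rfloor> log p \<le> log n! \<le> n log n\<close>; dropping the floor costs \<open>\<Sum> log p \<le> n log 4\<close>.
\<close>

lemma sum_ln_prime_over_prime_le:
  assumes "n \<ge> 1"
  shows "(\<Sum>p | prime p \<and> p \<le> n. ln (real p) / real p) \<le> ln (real n) + 2 * ln 2"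
proof -
  let ?P = "{p. prime p \<and> p \<le> n}"
  have "(\<Sum>p\<in>?P. ln (real p) * real (n div p))
      = (\<Sum>p\<in>?P. \<Sum>m\<in>{m\<in>{1..n}. p dvd m}. ln (real p))"
    using card_multiples[OF prime_gt_0_nat] by (intro sum.cong) (auto simp: mult.commute)
  also have "\<dots> = (\<Sum>m\<in>{1..n}. \<Sum>p\<in>{p\<in>?P. p dvd m}. ln (real p))"
    by (rule sum.swap_restrict) auto
  also have "\<dots> \<le> (\<Sum>m\<in>{1..n}. ln (real n))"
  proof (rule sum_mono)
    fix m assume m: "m \<in> {1..n}"
    have "{p. p \<in> ?P \<and> p dvd m} = {p. prime p \<and> p dvd m}"
    proof (intro Collect_cong)
      fix p show "(p \<in> ?P \<and> p dvd m) = (prime p \<and> p dvd m)"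
        using m dvd_imp_le[of p m] by auto
    qed
    then have "(\<Sum>p\<in>{p\<in>?P. p dvd m}. ln (real p)) \<le> ln (real m)"
      using sum_ln_prime_divisors_le[of m] m by simp
    also have "\<dots> \<le> ln (real n)" using m by simp
    finally show "(\<Sum>p\<in>{p\<in>?P. p dvd m}. ln (real p)) \<le> ln (real n)" .
  qed
  also have "\<dots> = real n * ln (real n)" by simp
  finally have 1: "(\<Sum>p\<in>?P. ln (real p) * real (n div p)) \<le> real n * ln (real n)" .
  have "real n * (\<Sum>p\<in>?P. ln (real p) / real p) = (\<Sum>p\<in>?P. ln (real p) * (real n / real p))"
    by (simp add: sum_distrib_left field_simps)
  also have "\<dots> \<le> (\<Sum>p\<in>?P. ln (real p) * real (n div p) + ln (real p))"
  proof (rule sum_mono)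
    fix p assume "p \<in> ?P"
    then have p: "p \<ge> 1" by (auto dest: prime_gt_0_nat)
    have "real n / real p \<le> real (n div p) + 1"
    proof -
      have "real n = real p * real (n div p) + real (n mod p)"
        by (metis mult_div_mod_eq of_nat_add of_nat_mult)
      moreover have "real (n mod p) \<le> real p" using p by (simp add: less_imp_le)
      ultimately show ?thesis using p by (simp add: field_simps)
    qed
    then have "ln (real p) * (real n / real p) \<le> ln (real p) * (real (n div p) + 1)"
      using p by (intro mult_left_mono) auto
    then show "ln (real p) * (real n / real p) \<le> ln (real p) * real (n div p) + ln (real p)"
      by (simp add: algebra_simps)
  qed
  also have "\<dots> \<le> real n * ln (real n) + real n * ln 4"
    using 1 sum_ln_primes_le[of n] by (simp add: sum.distrib)
  also have "\<dots> = real n * (ln (real n) + 2 * ln 2)"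
    using ln_realpow[of 2 2] by (simp add: algebra_simps)
  finally show ?thesis using assms by simp
qed

text \<open>
  Summation by parts on \<open>1/(k(k-1)) = 1/(k-1) - 1/k\<close> leaves \<open>log 2\<close> and the terms
  \<open>(log (k+1) - log k)/k \<le> 1/k\<^sup>2\<close>, which telescope against \<open>1/(k-1) - 1/k\<close>.  The subtracted term
  makes the induction close.
\<close>

lemma sum_ln_over_consecutive_le:
  assumes "n \<ge> 1"
  shows "(\<Sum>k=2..n. ln (real k) / (real k * (real k - 1))) \<le> ln 2 + 1 - (ln (real n + 1) + 1) / real n"
  using assms
proof (induction n rule: dec_induct)
  case base
  show ?case by simp
next
  case (step n)
  define x where "x = real n"
  have x: "x \<ge> 1" using step by (simp add: x_def)
  have "ln (x + 2) - ln (x + 1) \<le> 1 / (x + 1)"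
    using ln_diff_le_inverse[of "x + 1"] x by (simp add: add_ac)
  then have "(ln (x + 2) - ln (x + 1)) / (x + 1) \<le> 1 / (x + 1) / (x + 1)"
    using x by (intro divide_right_mono) auto
  also have "\<dots> \<le> 1 / x - 1 / (x + 1)"
  proof -
    have "1 / (x + 1) / (x + 1) \<le> 1 / (x * (x + 1))"
      using x by (simp add: frac_le)
    also have "\<dots> = 1 / x - 1 / (x + 1)" using x by (simp add: field_simps)
    finally show ?thesis .
  qed
  finally have *: "(ln (x + 2) - ln (x + 1)) / (x + 1) \<le> 1 / x - 1 / (x + 1)" .
  have "ln (x + 1) / ((x + 1) * x) = ln (x + 1) / x - ln (x + 1) / (x + 1)"
    using x by (simp add: divide_simps) (simp add: algebra_simps)
  with * have "ln (x + 1) / ((x + 1) * x) + (ln (x + 2) + 1) / (x + 1) \<le> (ln (x + 1) + 1) / x"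
    by (simp add: diff_divide_distrib add_divide_distrib)
  then have **: "ln (x + 1) / ((x + 1) * x) \<le> (ln (x + 1) + 1) / x - (ln (x + 2) + 1) / (x + 1)"
    by simp
  have "(\<Sum>k=2..Suc n. ln (real k) / (real k * (real k - 1)))
     = (\<Sum>k=2..n. ln (real k) / (real k * (real k - 1))) + ln (x + 1) / ((x + 1) * x)"
    using step by (simp add: x_def add_ac)
  also have "\<dots> \<le> ln 2 + 1 - (ln (x + 2) + 1) / (x + 1)"
    using step.IH ** by (simp add: x_def)
  finally show ?case by (simp add: x_def add_ac)
qed

text \<open>
  The sum with \<open>p - 1\<close> exceeds the one with \<open>p\<close> by \<open>\<Sum> log p / (p(p-1))\<close>, which converges.
\<close>

lemma sum_ln_prime_over_pred_le:
  assumes "x \<ge> 1"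
  shows "(\<Sum>p | prime p \<and> real p \<le> x. ln (real p) / (real p - 1)) \<le> ln x + 3 * ln 2 + 1"
proof -
  define n where "n = nat \<lfloor>x\<rfloor>"
  have n: "n \<ge> 1" "real n \<le> x" using assms by (auto simp: n_def le_nat_floor)
  have P: "{p. prime p \<and> real p \<le> x} = {p. prime p \<and> p \<le> n}" (is "_ = ?P")
    using n(2) by (auto simp: n_def le_nat_floor dest: of_nat_mono[where ?'a = real])
  have "(\<Sum>p\<in>?P. ln (real p) / (real p - 1))
      = (\<Sum>p\<in>?P. ln (real p) / real p) + (\<Sum>p\<in>?P. ln (real p) / (real p * (real p - 1)))"
    unfolding sum.distrib [symmetric]
  proof (rule sum.cong)
    fix p assume "p \<in> ?P"
    then have "real p \<ge> 2" by (auto dest: prime_ge_2_nat)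
    then show "ln (real p) / (real p - 1) = ln (real p) / real p + ln (real p) / (real p * (real p - 1))"
      by (simp add: divide_simps) (simp add: algebra_simps)
  qed simp
  moreover have "(\<Sum>p\<in>?P. ln (real p) / (real p * (real p - 1)))
      \<le> (\<Sum>k=2..n. ln (real k) / (real k * (real k - 1)))"
    by (intro sum_mono2) (auto dest: prime_ge_2_nat)
  moreover have "(ln (real n + 1) + 1) / real n \<ge> 0" by simp
  ultimately have "(\<Sum>p\<in>?P. ln (real p) / (real p - 1)) \<le> ln (real n) + 3 * ln 2 + 1"
    using sum_ln_prime_over_prime_le[OF n(1)] sum_ln_over_consecutive_le[OF n(1)] by linarith
  also have "\<dots> \<le> ln x + 3 * ln 2 + 1" using n by simp
  finally show ?thesis unfolding P .
qed

section \<open>The Mertens product over primes\<close>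

text \<open>
  The partial sums of \<open>\<zeta>(1 + s)\<close>, compared with the integral of \<open>t\<^bsup>-1-s\<^esup>\<close> in the form
  \<open>(1 - 1/n)\<^bsup>-s\<^esup> \<ge> 1 + s/n\<close>.
\<close>

lemma sum_powr_le:
  assumes "s > 0"
  shows "(\<Sum>n=1..m. real n powr (-1 - s)) \<le> 1 + 1 / s"
proof -
  have "(\<Sum>n=1..m. real n powr (-1 - s)) \<le> 1 + (1 - real m powr (-s)) / s" if "m \<ge> 1"
    using that
  proof (induction m rule: dec_induct)
    case (step m)
    define x where "x = real m + 1"
    have x: "x > 1" using step by (simp add: x_def)
    have "1 + s / x \<le> ((x - 1) / x) powr (-s)"
    proof -
      have "ln ((x - 1) / x) \<le> (x - 1) / x - 1"
        using x by (intro ln_le_minus_one) auto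
      also have "\<dots> = - 1 / x" using x by (simp add: field_simps)
      finally have "s * ln ((x - 1) / x) \<le> s * (- 1 / x)" using assms by (intro mult_left_mono) auto
      then have "1 + s / x \<le> 1 + (- s * ln ((x - 1) / x))" by simp
      also have "\<dots> \<le> exp (- s * ln ((x - 1) / x))" by (rule exp_ge_add_one_self)
      finally show ?thesis using x by (simp add: powr_def)
    qed
    then have "x powr (-s) * (1 + s / x) \<le> x powr (-s) * ((x - 1) / x) powr (-s)"
      by (intro mult_left_mono) auto
    also have "\<dots> = (x - 1) powr (-s)" using x by (simp flip: powr_mult)
    finally have "s * (x powr (-s) / x) \<le> (x - 1) powr (-s) - x powr (-s)"
      by (simp add: algebra_simps)
    moreover have "x powr (-1 - s) = x powr (-s) / x"
      using x powr_add[of x "-1" "-s"] by (simp add: powr_minus divide_simps mult.commute)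
    ultimately have "x powr (-1 - s) \<le> ((x - 1) powr (-s) - x powr (-s)) / s"
      using assms by (simp add: field_simps)
    then have "real (Suc m) powr (-1 - s) \<le> (real m powr (-s) - real (Suc m) powr (-s)) / s"
      by (simp add: x_def add_ac)
    with step show ?case by (simp add: diff_divide_distrib)
  qed simp
  moreover have "(1 - real m powr (-s)) / s \<le> 1 / s" using assms by (simp add: field_simps)
  ultimately show ?thesis using assms by (cases "m \<ge> 1") (auto simp: not_le)
qed

text \<open>
  A partial Euler product of \<open>\<zeta>(1 + s)\<close>.  Truncated geometric series multiply out to a sum over
  distinct integers by unique factorization, and the truncation is removed in the limit.
\<close>

lemma prod_prime_geometric_le:
  fixes A :: "nat set"
  assumes "finite A" "\<And>p. p \<in> A \<Longrightarrow> prime p" "s > 0"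
  shows "(\<Prod>p\<in>A. 1 / (1 - real p powr (-1 - s))) \<le> 1 + 1 / s"
proof (rule LIMSEQ_le_const2)
  define q where "q p = real p powr (-1 - s)" for p :: nat
  have q: "0 \<le> q p" "q p < 1" if "p \<in> A" for p
    using assms(2)[OF that] assms(3) prime_gt_1_nat[of p] by (auto simp: q_def powr_less_one)
  show "(\<lambda>J. \<Prod>p\<in>A. \<Sum>k<J. q p ^ k) \<longlonglongrightarrow> (\<Prod>p\<in>A. 1 / (1 - real p powr (-1 - s)))"
    unfolding q_def [symmetric] using q
    by (intro tendsto_prod geometric_sums [unfolded sums_def]) auto
  have "(\<Prod>p\<in>A. \<Sum>k<J. q p ^ k) \<le> 1 + 1 / s" for J
  proof -
    define E where "E = PiE A (\<lambda>_. {..<J})"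
    define v where "v e = (\<Prod>p\<in>A. p ^ e p)" for e :: "nat \<Rightarrow> nat"
    have finE: "finite E" using assms(1) by (simp add: E_def finite_PiE)
    have pos: "v e > 0" for e
      unfolding v_def using assms(2) by (intro prod_pos) (auto dest: prime_gt_0_nat)
    have inj: "inj_on v E"
    proof (rule inj_onI)
      fix e e' assume e: "e \<in> E" "e' \<in> E" "v e = v e'"
      have "e p = e' p" if "p \<in> A" for p
        using multiplicity_prod_prime_powers[of A p e] multiplicity_prod_prime_powers[of A p e']
          e(3) that assms(1,2) by (simp add: v_def)
      then show "e = e'" using e(1,2) unfolding E_def by (intro PiE_ext)
    qed
    define m where "m = Max (insert 1 (v ` E))"
    have sub: "v ` E \<subseteq> {1..m}"
      using finE pos by (auto simp: m_def Suc_le_eq)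
    have "(\<Prod>p\<in>A. \<Sum>k<J. q p ^ k) = (\<Sum>e\<in>E. \<Prod>p\<in>A. q p ^ e p)"
      unfolding E_def using assms(1) by (intro prod_sum_PiE) auto
    also have "\<dots> = (\<Sum>e\<in>E. real (v e) powr (-1 - s))"
    proof (rule sum.cong)
      fix e assume "e \<in> E"
      have "q p ^ e p = (real p ^ e p) powr (-1 - s)" if "p \<in> A" for p
      proof -
        have "real p > 0" using assms(2)[OF that] prime_gt_0_nat by simp
        then show ?thesis
          by (simp add: q_def powr_powr mult.commute flip: powr_realpow)
      qed
      then have "(\<Prod>p\<in>A. q p ^ e p) = (\<Prod>p\<in>A. (real p ^ e p) powr (-1 - s))" by simp
      also have "\<dots> = real (v e) powr (-1 - s)"
        by (simp add: v_def prod_powr_distrib)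
      finally show "(\<Prod>p\<in>A. q p ^ e p) = real (v e) powr (-1 - s)" .
    qed simp
    also have "\<dots> = (\<Sum>n\<in>v ` E. real n powr (-1 - s))"
      using inj by (simp add: sum.reindex)
    also have "\<dots> \<le> (\<Sum>n=1..m. real n powr (-1 - s))"
      using sub by (intro sum_mono2) auto
    also have "\<dots> \<le> 1 + 1 / s" using assms(3) by (rule sum_powr_le)
    finally show ?thesis .
  qed
  then show "\<exists>N. \<forall>n\<ge>N. (\<Prod>p\<in>A. \<Sum>k<n. q p ^ k) \<le> 1 + 1 / s" by blast
qed

text \<open>
  The upper bound in Mertens' third theorem by Rankin's trick: replacing \<open>1/p\<close> by \<open>p\<^bsup>-1-s\<^esup>\<close> in
  the Euler factor changes it by at most \<open>exp (s log p / (p-1))\<close>, so that with \<open>s\<close> of order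
  \<open>1 / log x\<close> the product is within a constant of \<open>\<zeta>(1 + s) \<le> 1 + 1/s\<close>.  The choice
  \<open>s = 1/(2 log x)\<close>, rather than \<open>1 / log x\<close>, favours small \<open>x\<close>, where the constant is critical.
\<close>

lemma mertens_product_le:
  assumes "x > 1"
  shows "(\<Prod>p | prime p \<and> real p \<le> x. real p / (real p - 1))
    \<le> (1 + 2 * ln x) * exp (1 / 2 + (3 * ln 2 + 1) / (2 * ln x))"
proof -
  let ?P = "{p::nat. prime p \<and> real p \<le> x}"
  define s where "s = 1 / (2 * ln x)"
  have l: "ln x > 0" using assms by simp
  have s: "s > 0" using l by (simp add: s_def)
  have "(\<Prod>p\<in>?P. real p / (real p - 1))
      \<le> (\<Prod>p\<in>?P. 1 / (1 - real p powr (-1 - s)) * exp (s * (ln (real p) / (real p - 1))))"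
  proof (rule prod_mono, intro conjI)
    fix p assume "p \<in> ?P"
    then have p: "real p \<ge> 2" by (auto dest: prime_ge_2_nat)
    show "0 \<le> real p / (real p - 1)" using p by simp
    define t where "t = real p powr (-s)"
    have t: "t < 1" using p s unfolding t_def by (intro powr_less_one) auto
    have "1 - s * ln (real p) \<le> t"
      using exp_ge_add_one_self[of "- s * ln (real p)"] p by (simp add: t_def powr_def)
    then have "1 - t \<le> s * ln (real p)" by simp
    then have "1 + (1 - t) / (real p - 1) \<le> 1 + s * (ln (real p) / (real p - 1))"
      using p by (simp add: divide_simps)
    also have "\<dots> \<le> exp (s * (ln (real p) / (real p - 1)))" by (rule exp_ge_add_one_self)
    finally have e: "1 + (1 - t) / (real p - 1) \<le> exp (s * (ln (real p) / (real p - 1)))" .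
    have pt: "real p powr (-1 - s) = t / real p"
      using p powr_add[of "real p" "-1" "-s"] by (simp add: powr_minus divide_simps mult.commute t_def)
    have "real p - t > 0" using p t by simp
    then have "real p / (real p - 1) = 1 / (1 - t / real p) * (1 + (1 - t) / (real p - 1))"
      using p by (simp add: divide_simps)
    also have "\<dots> \<le> 1 / (1 - t / real p) * exp (s * (ln (real p) / (real p - 1)))"
      using e p t by (intro mult_left_mono) auto
    finally show "real p / (real p - 1)
        \<le> 1 / (1 - real p powr (-1 - s)) * exp (s * (ln (real p) / (real p - 1)))"
      by (simp add: pt)
  qed
  also have "\<dots> = (\<Prod>p\<in>?P. 1 / (1 - real p powr (-1 - s)))
      * exp (s * (\<Sum>p\<in>?P. ln (real p) / (real p - 1)))"
    by (simp only: prod.distrib exp_sum [OF finite_primes_le] sum_distrib_left)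
  also have "\<dots> \<le> (1 + 1 / s) * exp (s * (ln x + 3 * ln 2 + 1))"
  proof (rule mult_mono)
    show "(\<Prod>p\<in>?P. 1 / (1 - real p powr (-1 - s))) \<le> 1 + 1 / s"
      using s by (intro prod_prime_geometric_le finite_primes_le) auto
    have "(\<Sum>p\<in>?P. ln (real p) / (real p - 1)) \<le> ln x + 3 * ln 2 + 1"
      using assms by (intro sum_ln_prime_over_pred_le) simp
    then show "exp (s * (\<Sum>p\<in>?P. ln (real p) / (real p - 1))) \<le> exp (s * (ln x + 3 * ln 2 + 1))"
      using s by (simp only: exp_le_cancel_iff mult_left_mono less_imp_le)
  qed (use s in auto)
  also have "\<dots> = (1 + 2 * ln x) * exp (1 / 2 + (3 * ln 2 + 1) / (2 * ln x))"
    using l by (simp add: s_def add_divide_distrib)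
  finally show ?thesis .
qed

section \<open>The sifting density\<close>

text \<open>
  A squarefree integer composed of primes in \<open>P\<close> is represented by its set of prime factors.  Since
  \<open>\<phi>(q) = \<Prod> (p - 1)\<close> for such \<open>q\<close>, the following sum is Selberg's \<open>G = \<Sum>\<^bsub>q \<le> z\<^esub> 1/\<phi>(q)\<close>,
  restricted to \<open>q\<close> composed of primes in \<open>P\<close>.
\<close>

definition sieve_sets :: "nat set \<Rightarrow> real \<Rightarrow> nat set set" where
  "sieve_sets P z = {Q. Q \<subseteq> P \<and> real (\<Prod>Q) \<le> z}"

definition sieve_sum :: "nat set \<Rightarrow> real \<Rightarrow> real" where
  "sieve_sum P z = (\<Sum>Q\<in>sieve_sets P z. \<Prod>p\<in>Q. 1 / (real p - 1))"

lemma finite_sieve_sets [simp]: "finite P \<Longrightarrow> finite (sieve_sets P z)"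
  unfolding sieve_sets_def by (rule finite_subset[of _ "Pow P"]) auto

text \<open>
  The reciprocals of the integers \<open>n \<le> z\<close> sum to at least \<open>log z\<close>.  Sort them by the set \<open>Q\<close> of
  prime factors of \<open>n\<close> above \<open>w\<close>: the product of \<open>Q\<close> is at most \<open>n \<le> z\<close>, so \<open>Q\<close> is one of the
  sieve sets, and summing freely over all exponents gives \<open>1/(p-1)\<close> for each \<open>p \<in> Q\<close>
  and \<open>p/(p-1)\<close> for each prime \<open>p \<le> w\<close>.
\<close>

lemma ln_le_prod_times_sieve_sum:
  assumes "z \<ge> 1"
  shows "ln z \<le> (\<Prod>p | prime p \<and> real p \<le> w. real p / (real p - 1))
    * sieve_sum {p. prime p \<and> w < real p \<and> real p \<le> z} z"
proof -
  define S where "S = {p::nat. prime p \<and> real p \<le> w}"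
  define P where "P = {p::nat. prime p \<and> w < real p \<and> real p \<le> z}"
  define A where "A = S \<union> P"
  define m where "m = nat \<lfloor>z\<rfloor>"
  have fin: "finite S" "finite P" "finite A"
    by (auto simp: S_def P_def A_def intro: finite_subset[OF _ finite_primes_le[of z]])
  have disj: "S \<inter> P = {}" by (auto simp: S_def P_def)
  have prime: "prime p" if "p \<in> A" for p using that by (auto simp: A_def S_def P_def)
  have mz: "real m \<le> z" using assms by (simp add: m_def)
  define B where "B Q p = (if p \<in> S then {..m} else if p \<in> Q then {1..m} else {0})"
    for Q and p :: nat
  define \<phi> where "\<phi> n = restrict (\<lambda>p. multiplicity p n) A" for n :: nat
  define \<psi> where "\<psi> n = {p\<in>P. p dvd n}" for n :: nat
  define v where "v e = (\<Prod>p\<in>A. (1 / real p) ^ e p)" for e :: "nat \<Rightarrow> nat"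
  define T where "T = Sigma (sieve_sets P z) (\<lambda>Q. PiE A (B Q))"
  \<comment> \<open>An integer is determined by its exponents, which makes the sorting injective.\<close>
  have recover: "(\<Prod>p\<in>A. p ^ \<phi> n p) = n" if n: "n \<in> {1..m}" for n
  proof -
    have "n = (\<Prod>p\<in>prime_factors n. p ^ multiplicity p n)"
      using n by (intro prime_factorization_nat) auto
    also have "\<dots> = (\<Prod>p\<in>A. p ^ multiplicity p n)"
    proof (rule prod.mono_neutral_left)
      show "prime_factors n \<subseteq> A"
      proof
        fix p assume "p \<in> prime_factors n"
        then have "prime p" "p dvd n" by auto
        moreover from this n have "p \<le> m" using dvd_imp_le[of p n] by auto
        then have "real p \<le> z" using mz by linarith
        ultimately show "p \<in> A" by (auto simp: A_def S_def P_def)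
      qed
      show "\<forall>p\<in>A - prime_factors n. p ^ multiplicity p n = 1"
        using prime by (auto simp: prime_factors_multiplicity)
    qed (rule fin)
    also have "\<dots> = (\<Prod>p\<in>A. p ^ \<phi> n p)" by (simp add: \<phi>_def)
    finally show ?thesis by simp
  qed
  have "ln z \<le> ln (real m + 1)"
  proof -
    have "z \<le> real m + 1" using assms unfolding m_def by linarith
    then show ?thesis using assms by simp
  qed
  also have "\<dots> \<le> harm m" by (rule ln_le_harm)
  also have "\<dots> = (\<Sum>n=1..m. v (\<phi> n))"
    unfolding harm_def
  proof (rule sum.cong)
    fix n assume n: "n \<in> {1..m}"
    have "v (\<phi> n) = 1 / real (\<Prod>p\<in>A. p ^ \<phi> n p)"
      by (simp add: v_def power_one_over prod_dividef)
    then show "inverse (of_nat n) = v (\<phi> n)"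
      by (simp only: recover[OF n] inverse_eq_divide)
  qed simp
  also have "\<dots> = (\<Sum>(Q, e)\<in>(\<lambda>n. (\<psi> n, \<phi> n)) ` {1..m}. v e)"
  proof (subst sum.reindex)
    show "inj_on (\<lambda>n. (\<psi> n, \<phi> n)) {1..m}"
      by (rule inj_onI) (metis recover prod.inject)
  qed simp
  also have "\<dots> \<le> (\<Sum>(Q, e)\<in>T. v e)"
  proof (rule sum_mono2)
    show "finite T"
      unfolding T_def using fin by (intro finite_SigmaI finite_sieve_sets finite_PiE) (auto simp: B_def)
    show "(\<lambda>n. (\<psi> n, \<phi> n)) ` {1..m} \<subseteq> T"
    proof (clarify, unfold T_def, intro SigmaI)
      fix n assume n: "n \<in> {1..m}"
      have "\<Prod>(\<psi> n) dvd n"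
        using finite_subset[OF _ fin(2), of "\<psi> n"]
        by (intro prod_primes_dvd) (auto simp: \<psi>_def P_def)
      then have "\<Prod>(\<psi> n) \<le> n" using n by (intro dvd_imp_le) auto
      then have "real (\<Prod>(\<psi> n)) \<le> z" using n mz by (metis atLeastAtMost_iff of_nat_mono order.trans)
      then show "\<psi> n \<in> sieve_sets P z" by (auto simp: sieve_sets_def \<psi>_def)
      show "\<phi> n \<in> PiE A (B (\<psi> n))"
      proof (rule PiE_I)
        fix p assume p: "p \<in> A"
        have "multiplicity p n < p ^ multiplicity p n"
          using prime[OF p] prime_gt_1_nat by (intro power_gt_expt) auto
        also have "\<dots> \<le> n" using n by (intro dvd_imp_le multiplicity_dvd) auto
        finally have "multiplicity p n \<le> m" using n by simp
        moreover have "multiplicity p n \<noteq> 0 \<longleftrightarrow> p dvd n"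
          using prime[OF p] n prime_multiplicity_gt_zero_iff[of p n] by auto
        ultimately show "\<phi> n p \<in> B (\<psi> n) p"
          using p by (auto simp: \<phi>_def B_def \<psi>_def A_def)
      qed (simp add: \<phi>_def)
    qed
  qed (auto simp: v_def intro!: prod_nonneg)
  also have "\<dots> = (\<Sum>Q\<in>sieve_sets P z. \<Sum>e\<in>PiE A (B Q). v e)"
    unfolding T_def using fin
    by (intro sum.Sigma [symmetric] ballI finite_sieve_sets finite_PiE) (auto simp: B_def)
  also have "\<dots> \<le> (\<Sum>Q\<in>sieve_sets P z. (\<Prod>p\<in>S. real p / (real p - 1)) * (\<Prod>p\<in>Q. 1 / (real p - 1)))"
  proof (rule sum_mono)
    fix Q assume "Q \<in> sieve_sets P z"
    then have Q: "Q \<subseteq> P" by (simp add: sieve_sets_def)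
    have geo: "(\<Sum>k\<le>m. (1 / real p) ^ k) \<le> real p / (real p - 1)" if "p \<in> A" for p
    proof -
      have p: "real p > 1" using prime[OF that] prime_gt_1_nat by simp
      have "(\<Sum>k\<le>m. (1 / real p) ^ k) \<le> 1 / (1 - 1 / real p)"
        using p by (subst sum_gp0) (auto simp: divide_simps)
      also have "\<dots> = real p / (real p - 1)" using p by (simp add: divide_simps)
      finally show ?thesis .
    qed
    have geo1: "(\<Sum>k=1..m. (1 / real p) ^ k) \<le> 1 / (real p - 1)" if "p \<in> A" for p
    proof -
      have p: "real p > 1" using prime[OF that] prime_gt_1_nat by simp
      have "(\<Sum>k\<le>m. (1 / real p) ^ k) = 1 + (\<Sum>k=1..m. (1 / real p) ^ k)"
        by (simp add: sum.atLeast1_atMost_eq sum.atMost_shift)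
      moreover have "real p / (real p - 1) = 1 + 1 / (real p - 1)" using p by (simp add: divide_simps)
      ultimately show ?thesis using geo[OF that] by linarith
    qed
    have "(\<Sum>e\<in>PiE A (B Q). v e) = (\<Prod>p\<in>A. \<Sum>k\<in>B Q p. (1 / real p) ^ k)"
      unfolding v_def using fin by (intro prod_sum_PiE [symmetric]) (auto simp: B_def)
    also have "\<dots> = (\<Prod>p\<in>S. \<Sum>k\<in>B Q p. (1 / real p) ^ k) * (\<Prod>p\<in>P. \<Sum>k\<in>B Q p. (1 / real p) ^ k)"
      unfolding A_def using fin disj by (intro prod.union_disjoint) auto
    also have "\<dots> \<le> (\<Prod>p\<in>S. real p / (real p - 1)) * (\<Prod>p\<in>P. if p \<in> Q then 1 / (real p - 1) else 1)"
    proof (intro mult_mono prod_mono prod_nonneg conjI sum_nonneg)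
      fix p assume "p \<in> S"
      then show "(\<Sum>k\<in>B Q p. (1 / real p) ^ k) \<le> real p / (real p - 1)"
        using geo[of p] by (simp add: B_def A_def)
    next
      fix p assume "p \<in> P"
      then show "(\<Sum>k\<in>B Q p. (1 / real p) ^ k) \<le> (if p \<in> Q then 1 / (real p - 1) else 1)"
        using geo1[of p] disj by (auto simp: B_def A_def)
    next
      fix p assume "p \<in> S"
      then show "0 \<le> real p / (real p - 1)"
        by (auto simp: S_def dest!: prime_gt_1_nat)
    qed auto
    also have "(\<Prod>p\<in>P. if p \<in> Q then 1 / (real p - 1) else 1) = (\<Prod>p\<in>Q. 1 / (real p - 1))"
      using Q fin by (simp add: prod.If_cases Int_absorb1 flip: prod.inter_restrict)
    finally show "(\<Sum>e\<in>PiE A (B Q). v e)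
        \<le> (\<Prod>p\<in>S. real p / (real p - 1)) * (\<Prod>p\<in>Q. 1 / (real p - 1))" .
  qed
  also have "\<dots> = (\<Prod>p\<in>S. real p / (real p - 1)) * sieve_sum P z"
    by (simp add: sieve_sum_def sum_distrib_left)
  finally show ?thesis unfolding S_def P_def .
qed

section \<open>Additive characters and the kernel of an averaged window\<close>

lemma ee_add: "ee (x + y) = ee x * ee y"
  by (simp add: ee_def exp_add ring_distribs)

lemma ee_0 [simp]: "ee 0 = 1" by (simp add: ee_def)

lemma ee_cis: "ee x = cis (2 * pi * x)"
  by (simp add: ee_def cis_conv_exp mult_ac)

lemma norm_ee [simp]: "norm (ee x) = 1" by (simp add: ee_cis)

lemma cnj_ee: "cnj (ee x) = ee (- x)"
  by (simp add: ee_cis cis_cnj)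

lemma ee_sum: "ee (sum f A) = (\<Prod>a\<in>A. ee (f a))"
  by (induction A rule: infinite_finite_induct) (auto simp: ee_add)

lemma ee_power: "ee (of_nat n * x) = ee x ^ n"
  by (induction n) (auto simp: ring_distribs ee_add mult.commute)

lemma int_dist_nonneg: "0 \<le> int_dist x"
  using int_dist_attained[of x] by auto

lemma int_dist_le_half: "int_dist x \<le> 1 / 2"
  using int_dist_le[of x "round x"] of_int_round_abs_le[of x] by (simp add: abs_minus_commute)

lemma int_dist_minus: "int_dist (- x) = int_dist x"
proof -
  have "int_dist (- u) \<le> int_dist u" for u
  proof -
    obtain k :: int where "int_dist u = \<bar>u - of_int k\<bar>" using int_dist_attained by blast
    then show ?thesis using int_dist_le[of "-u" "-k"] by simp
  qed
  from this[of x] this[of "- x"] show ?thesis by simp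
qed

text \<open>
  Jordan's inequality, from the concavity of the sine on \<open>[0, \<pi>]\<close>.
\<close>

lemma sin_pi_ge:
  assumes "0 \<le> t" "t \<le> 1 / 2"
  shows "2 * t \<le> sin (pi * t)"
proof -
  have "concave_on {0..pi} sin"
  proof (rule f''_le0_imp_concave[where f' = cos and f'' = "\<lambda>x. - sin x"])
    fix x :: real assume "x \<in> {0..pi}"
    then show "- sin x \<le> 0" using sin_ge_zero by simp
  qed (auto intro!: derivative_eq_intros)
  then have "convex_on {0..pi} (\<lambda>x. - sin x)" by (simp add: concave_on_def)
  from convex_onD[OF this, of "2 * t" 0 "pi / 2"] assms
  show ?thesis by (simp add: mult.commute)
qed

text \<open>
  The chord has length \<open>2 |sin \<pi>x|\<close>.
\<close>

lemma norm_one_minus_ee_ge: "4 * int_dist x \<le> norm (1 - ee x)"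
proof -
  obtain k :: int where k: "int_dist x = \<bar>x - of_int k\<bar>" using int_dist_attained by blast
  define t where "t = x - of_int k"
  have ee: "ee x = ee t" unfolding t_def by (rule ee_cong) simp
  have h: "\<bar>t\<bar> \<le> 1 / 2" using int_dist_le_half[of x] k by (simp add: t_def)
  have "norm (1 - ee t) = 2 * \<bar>sin (pi * t)\<bar>"
  proof -
    have "norm (1 - ee t) ^ 2 = (1 - cos (2 * (pi * t)))\<^sup>2 + (sin (2 * (pi * t)))\<^sup>2"
      unfolding cmod_power2 by (simp add: ee_cis mult_ac)
    also have "\<dots> = 2 - 2 * cos (2 * (pi * t))"
      using sin_cos_squared_add[of "2 * (pi * t)"] by (simp add: power2_eq_square algebra_simps)
    also have "\<dots> = (2 * \<bar>sin (pi * t)\<bar>) ^ 2"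
      by (simp add: cos_double_sin power2_eq_square)
    finally show ?thesis by (rule power2_eq_imp_eq) auto
  qed
  moreover have "2 * \<bar>t\<bar> \<le> \<bar>sin (pi * t)\<bar>"
    using sin_pi_ge[of "\<bar>t\<bar>"] h by (cases "t \<ge> 0") auto
  ultimately show ?thesis using k ee by (simp add: t_def)
qed

definition dirichlet_sum :: "nat \<Rightarrow> real \<Rightarrow> complex" where
  "dirichlet_sum H t = (\<Sum>i<H. ee (of_nat i * t))"

lemma norm_dirichlet_sum_le: "norm (dirichlet_sum H t) \<le> real H"
  unfolding dirichlet_sum_def by (rule order.trans[OF norm_sum]) simp

lemma norm_dirichlet_sum_le_inverse:
  assumes "int_dist t > 0"
  shows "norm (dirichlet_sum H t) \<le> 1 / (2 * int_dist t)"
proof -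
  have ne: "norm (1 - ee t) > 0" using norm_one_minus_ee_ge[of t] assms by linarith
  then have "ee t \<noteq> 1" by auto
  then have "dirichlet_sum H t = (1 - ee t ^ H) / (1 - ee t)"
    by (simp add: dirichlet_sum_def ee_power sum_gp_strict)
  then have "norm (dirichlet_sum H t) = norm (1 - ee t ^ H) / norm (1 - ee t)"
    by (simp add: norm_divide)
  also have "\<dots> \<le> 2 / norm (1 - ee t)"
    using norm_triangle_ineq4[of 1 "ee t ^ H"] by (intro divide_right_mono) (auto simp: norm_power)
  also have "\<dots> \<le> 2 / (4 * int_dist t)"
    using norm_one_minus_ee_ge[of t] assms ne by (intro divide_left_mono) auto
  finally show ?thesis by simp
qed

text \<open>
  The normalized transform of the autocorrelation of intervals of lengths \<open>H\<close> and \<open>J\<close>: it is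
  \<open>\<Sum> v(n) e(nt)\<close> with \<open>J v(n)\<close> the number of ways to write \<open>n = i - j\<close>, \<open>i < H\<close>, \<open>j < J\<close>.  The weight
  \<open>v\<close> equals 1 on \<open>0 \<le> n \<le> H - J\<close>, while its transform decays quadratically.
\<close>

definition window_kernel :: "nat \<Rightarrow> nat \<Rightarrow> real \<Rightarrow> complex" where
  "window_kernel H J t = dirichlet_sum H t * dirichlet_sum J (- t) / of_nat J"

lemma norm_window_kernel_le:
  "norm (window_kernel H J t) \<le> real H"
proof (cases "J = 0")
  case False
  have "norm (dirichlet_sum H t) * norm (dirichlet_sum J (- t)) \<le> real H * real J"
    by (intro mult_mono norm_dirichlet_sum_le) auto
  then show ?thesis using False by (simp add: window_kernel_def norm_mult norm_divide divide_simps)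
qed (simp add: window_kernel_def)

lemma norm_window_kernel_le_inverse:
  assumes "int_dist t > 0"
  shows "norm (window_kernel H J t) \<le> 1 / (4 * real J * (int_dist t)\<^sup>2)"
proof (cases "J = 0")
  case False
  have "norm (dirichlet_sum H t) * norm (dirichlet_sum J (- t))
      \<le> 1 / (2 * int_dist t) * (1 / (2 * int_dist t))"
    using norm_dirichlet_sum_le_inverse[of t] norm_dirichlet_sum_le_inverse[of "- t"] assms
    by (intro mult_mono) (auto simp: int_dist_minus int_dist_nonneg)
  also have "\<dots> = 1 / (4 * (int_dist t)\<^sup>2)" by (simp add: power2_eq_square)
  finally have "norm (dirichlet_sum H t) * norm (dirichlet_sum J (- t)) / real J
      \<le> 1 / (4 * (int_dist t)\<^sup>2) / real J" by (intro divide_right_mono) auto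
  then show ?thesis by (simp add: window_kernel_def norm_mult norm_divide mult_ac)
qed (simp add: window_kernel_def)

text \<open>
  For \<open>k \<ge> 2\<close>, \<open>1/k\<^sup>2 \<le> 1/(k - 1/2) - 1/(k + 1/2)\<close> telescopes.
\<close>

lemma sum_inverse_squares_le: "(\<Sum>k=1..n. 1 / (real k)\<^sup>2) \<le> 5 / 3"
proof -
  have "(\<Sum>k=1..n. 1 / (real k)\<^sup>2) \<le> 5 / 3 - 1 / (real n + 1 / 2)" if "n \<ge> 1"
    using that
  proof (induction n rule: dec_induct)
    case (step n)
    define x where "x = real n"
    have x: "x \<ge> 1" using step by (simp add: x_def)
    have "1 / (x + 1)\<^sup>2 \<le> 1 / ((x + 1 / 2) * (x + 3 / 2))"
    proof (rule divide_left_mono)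
      show "(x + 1 / 2) * (x + 3 / 2) \<le> (x + 1)\<^sup>2"
        by (simp add: power2_eq_square field_simps)
      have "0 < (x + 1)\<^sup>2" "0 < (x + 1 / 2) * (x + 3 / 2)" using x by auto
      then show "0 < (x + 1)\<^sup>2 * ((x + 1 / 2) * (x + 3 / 2))" by (rule mult_pos_pos)
    qed simp
    also have "\<dots> = 1 / (x + 1 / 2) - 1 / (x + 3 / 2)"
      using x by (simp add: field_simps)
    finally show ?case using step by (simp add: x_def add_ac)
  qed simp
  moreover have "1 / (real n + 1 / 2) \<ge> 0" by simp
  ultimately show ?thesis
    by (cases "n \<ge> 1") (linarith, simp)
qed

text \<open>
  The representative of \<open>x\<close> modulo 1 in \<open>[-1/2, 1/2]\<close>.
\<close>

definition centred_frac :: "real \<Rightarrow> real" where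
  "centred_frac x = x - of_int (round x)"

lemma abs_centred_frac: "\<bar>centred_frac x\<bar> = int_dist x"
proof (rule antisym)
  obtain k where "int_dist x = \<bar>x - of_int k\<bar>" using int_dist_attained by blast
  then show "\<bar>centred_frac x\<bar> \<le> int_dist x"
    using round_diff_minimal[of x k] by (simp add: centred_frac_def)
  show "int_dist x \<le> \<bar>centred_frac x\<bar>" unfolding centred_frac_def by (rule int_dist_le)
qed

lemma int_dist_diff_le: "int_dist (x - y) \<le> \<bar>centred_frac (x - w) - centred_frac (y - w)\<bar>"
  using int_dist_le[of "x - y" "round (x - w) - round (y - w)"]
  by (simp add: centred_frac_def algebra_simps)

text \<open>
  An indexed form of well-spacedness, with real representatives of points of the circle.
\<close>

definition spaced :: "real \<Rightarrow> 'i set \<Rightarrow> ('i \<Rightarrow> real) \<Rightarrow> bool" where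
  "spaced \<delta> X u \<longleftrightarrow> (\<forall>x\<in>X. \<forall>y\<in>X. x \<noteq> y \<longrightarrow> \<delta> \<le> int_dist (u x - u y))"

text \<open>
  On each side of \<open>w\<close> there is at most one point at distance in \<open>[k\<delta>, (k+1)\<delta>)\<close>, since two of them
  would be closer than \<open>\<delta>\<close>.
\<close>

lemma spaced_annulus_inj:
  assumes "spaced \<delta> X u" "\<delta> > 0"
  shows "inj_on (\<lambda>x. (centred_frac (u x - w) \<ge> 0, nat \<lfloor>int_dist (u x - w) / \<delta>\<rfloor>)) X"
proof (rule inj_onI, rule ccontr)
  fix x y assume xy: "x \<in> X" "y \<in> X" "x \<noteq> y"
    and eq: "(centred_frac (u x - w) \<ge> 0, nat \<lfloor>int_dist (u x - w) / \<delta>\<rfloor>)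
      = (centred_frac (u y - w) \<ge> 0, nat \<lfloor>int_dist (u y - w) / \<delta>\<rfloor>)"
  let ?r = "int_dist (u x - w)" and ?s = "int_dist (u y - w)"
  have nn: "0 \<le> \<lfloor>?r / \<delta>\<rfloor>" "0 \<le> \<lfloor>?s / \<delta>\<rfloor>" using assms(2) int_dist_nonneg by auto
  have "\<lfloor>?r / \<delta>\<rfloor> = \<lfloor>?s / \<delta>\<rfloor>" using eq nn by (simp add: eq_nat_nat_iff)
  then have "\<bar>?r / \<delta> - ?s / \<delta>\<bar> < 1" by linarith
  then have "\<bar>?r - ?s\<bar> < \<delta>"
    using assms(2) by (simp add: divide_simps abs_if split: if_splits)
  moreover have "\<bar>centred_frac (u x - w) - centred_frac (u y - w)\<bar> = \<bar>?r - ?s\<bar>"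
    using eq abs_centred_frac[of "u x - w"] abs_centred_frac[of "u y - w"]
    by (cases "centred_frac (u x - w) \<ge> 0") auto
  moreover have "\<delta> \<le> int_dist (u x - u y)"
    using assms(1) xy by (auto simp: spaced_def)
  ultimately show False using int_dist_diff_le[of "u x" "u y" w] by linarith
qed

text \<open>
  Two points at most for each \<open>k \<ge> 1\<close>, each contributing at most \<open>1/(k\<delta>)\<^sup>2\<close>.
\<close>

lemma sum_inverse_square_spaced_le:
  assumes "finite X" "spaced \<delta> X u" "\<delta> > 0"
  shows "(\<Sum>x | x \<in> X \<and> \<delta> \<le> int_dist (u x - w). 1 / (int_dist (u x - w))\<^sup>2) \<le> 10 / (3 * \<delta>\<^sup>2)"
proof -
  define Y where "Y = {x\<in>X. \<delta> \<le> int_dist (u x - w)}"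
  define g where "g x = (centred_frac (u x - w) \<ge> 0, nat \<lfloor>int_dist (u x - w) / \<delta>\<rfloor>)" for x
  have fin: "finite Y" using assms(1) by (simp add: Y_def)
  have inj: "inj_on g Y"
    unfolding g_def using spaced_annulus_inj[OF assms(2,3)] by (rule inj_on_subset) (auto simp: Y_def)
  define n where "n = Max (insert 0 (snd ` g ` Y))"
  have k: "1 \<le> snd (g x)" "real (snd (g x)) * \<delta> \<le> int_dist (u x - w)" if "x \<in> Y" for x
  proof -
    have "1 \<le> int_dist (u x - w) / \<delta>" using that assms(3) by (simp add: Y_def)
    then have 1: "1 \<le> \<lfloor>int_dist (u x - w) / \<delta>\<rfloor>" by simp
    then show "1 \<le> snd (g x)" unfolding g_def snd_conv by linarith
    have "real (snd (g x)) \<le> int_dist (u x - w) / \<delta>"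
      using 1 by (simp add: g_def)
    then show "real (snd (g x)) * \<delta> \<le> int_dist (u x - w)"
      using assms(3) by (simp add: field_simps)
  qed
  have sub: "g ` Y \<subseteq> UNIV \<times> {1..n}"
  proof
    fix z assume "z \<in> g ` Y"
    then obtain x where x: "x \<in> Y" "z = g x" by auto
    have "snd (g x) \<le> n" unfolding n_def using fin x by (intro Max_ge) auto
    then show "z \<in> UNIV \<times> {1..n}" using k(1)[OF x(1)] x(2) by (cases "g x") auto
  qed
  have "(\<Sum>x\<in>Y. 1 / (int_dist (u x - w))\<^sup>2) \<le> (\<Sum>x\<in>Y. 1 / \<delta>\<^sup>2 * (1 / (real (snd (g x)))\<^sup>2))"
  proof (rule sum_mono)
    fix x assume x: "x \<in> Y"
    have "0 < real (snd (g x)) * \<delta>" using k(1)[OF x] assms(3) by simp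
    then have "1 / (int_dist (u x - w))\<^sup>2 \<le> 1 / (real (snd (g x)) * \<delta>)\<^sup>2"
      using k(2)[OF x] by (intro frac_le power_mono zero_less_power) auto
    then show "1 / (int_dist (u x - w))\<^sup>2 \<le> 1 / \<delta>\<^sup>2 * (1 / (real (snd (g x)))\<^sup>2)"
      by (simp add: power_mult_distrib mult.commute)
  qed
  also have "\<dots> = 1 / \<delta>\<^sup>2 * (\<Sum>z\<in>g ` Y. 1 / (real (snd z))\<^sup>2)"
    using inj by (simp add: sum.reindex sum_distrib_left)
  also have "\<dots> \<le> 1 / \<delta>\<^sup>2 * (\<Sum>z\<in>(UNIV :: bool set) \<times> {1..n}. 1 / (real (snd z))\<^sup>2)"
  proof (rule mult_left_mono)
    show "(\<Sum>z\<in>g ` Y. 1 / (real (snd z))\<^sup>2) \<le> (\<Sum>z\<in>(UNIV :: bool set) \<times> {1..n}. 1 / (real (snd z))\<^sup>2)"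
      by (rule sum_mono2[OF _ sub]) auto
  qed simp
  also have "\<dots> = 1 / \<delta>\<^sup>2 * (2 * (\<Sum>k=1..n. 1 / (real k)\<^sup>2))"
    by (simp add: sum.cartesian_product' UNIV_bool)
  also have "\<dots> \<le> 1 / \<delta>\<^sup>2 * (2 * (5 / 3))"
    by (intro mult_left_mono sum_inverse_squares_le) auto
  finally show ?thesis by (simp add: Y_def)
qed

lemma card_spaced_near_le:
  assumes "finite X" "spaced \<delta> X u" "\<delta> > 0"
  shows "card {x\<in>X. int_dist (u x - w) < \<delta>} \<le> 2"
proof -
  let ?Y = "{x\<in>X. int_dist (u x - w) < \<delta>}"
  let ?g = "\<lambda>x. (centred_frac (u x - w) \<ge> 0, nat \<lfloor>int_dist (u x - w) / \<delta>\<rfloor>)"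
  have "?g ` ?Y \<subseteq> UNIV \<times> {0}"
  proof (rule image_subsetI)
    fix x assume "x \<in> ?Y"
    then have "int_dist (u x - w) / \<delta> < 1" using assms(3) by simp
    then have "\<lfloor>int_dist (u x - w) / \<delta>\<rfloor> < 1" by (simp add: floor_less_iff)
    then show "?g x \<in> UNIV \<times> {0}" by auto
  qed
  then have "card (?g ` ?Y) \<le> card (UNIV \<times> {0::nat} :: (bool \<times> nat) set)"
    by (intro card_mono) auto
  moreover have "card (?g ` ?Y) = card ?Y"
    by (rule card_image, rule inj_on_subset[OF spaced_annulus_inj[OF assms(2,3)]]) auto
  ultimately show ?thesis by (simp add: card_cartesian_product)
qed

text \<open>
  Points near \<open>w\<close> are bounded trivially, the others by quadratic decay.  The count \<open>c\<close> is a parameter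
  because it is 1 when \<open>w\<close> is itself one of the points and 2 in general.
\<close>

lemma sum_window_kernel_spaced_le:
  assumes "finite X" "spaced \<delta> X u" "\<delta> > 0"
    and c: "card {x\<in>X. int_dist (u x - w) < \<delta>} \<le> c"
  shows "(\<Sum>x\<in>X. norm (window_kernel H J (u x - w))) \<le> real c * real H + 5 / (6 * real J * \<delta>\<^sup>2)"
proof -
  let ?N = "{x\<in>X. int_dist (u x - w) < \<delta>}" and ?F = "{x\<in>X. \<delta> \<le> int_dist (u x - w)}"
  have "(\<Sum>x\<in>X. norm (window_kernel H J (u x - w)))
      = (\<Sum>x\<in>?N. norm (window_kernel H J (u x - w))) + (\<Sum>x\<in>?F. norm (window_kernel H J (u x - w)))"
    using assms(1) by (subst sum.union_disjoint [symmetric]) (auto intro!: sum.cong)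
  also have "(\<Sum>x\<in>?N. norm (window_kernel H J (u x - w))) \<le> real (card ?N) * real H"
    using norm_window_kernel_le by (intro sum_bounded_above) auto
  also have "\<dots> \<le> real c * real H" using c by (intro mult_right_mono) auto
  also have "(\<Sum>x\<in>?F. norm (window_kernel H J (u x - w)))
      \<le> (\<Sum>x\<in>?F. 1 / (4 * real J) * (1 / (int_dist (u x - w))\<^sup>2))"
    using norm_window_kernel_le_inverse assms(3) by (intro sum_mono) fastforce
  also have "\<dots> = 1 / (4 * real J) * (\<Sum>x\<in>?F. 1 / (int_dist (u x - w))\<^sup>2)"
    by (simp add: sum_distrib_left)
  also have "\<dots> \<le> 1 / (4 * real J) * (10 / (3 * \<delta>\<^sup>2))"
    using sum_inverse_square_spaced_le[OF assms(1-3), of w] by (intro mult_left_mono) auto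
  also have "\<dots> = 5 / (6 * real J * \<delta>\<^sup>2)" by (simp add: field_simps)
  finally show ?thesis by simp
qed

section \<open>The large sieve inequality\<close>

lemma int_dist_zero_imp_Ints: "int_dist x = 0 \<Longrightarrow> x \<in> \<int>"
  using int_dist_attained[of x] by auto

lemma ee_eq_1_imp_Ints: "ee x = 1 \<Longrightarrow> x \<in> \<int>"
  using norm_one_minus_ee_ge[of x] int_dist_nonneg[of x] by (intro int_dist_zero_imp_Ints) simp

lemma window_kernel_cong: "x - y \<in> \<int> \<Longrightarrow> window_kernel H J x = window_kernel H J y"
proof -
  assume xy: "x - y \<in> \<int>"
  have "ee (of_nat i * x) = ee (of_nat i * y)" for i
    using xy by (intro ee_cong) (simp flip: right_diff_distrib)
  moreover have "ee (of_nat i * (- x)) = ee (of_nat i * (- y))" for i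
  proof (rule ee_cong)
    have "of_nat i * (- x) - of_nat i * (- y) = - (of_nat i * (x - y))" by (simp add: algebra_simps)
    then show "of_nat i * (- x) - of_nat i * (- y) \<in> \<int>" using xy by simp
  qed
  ultimately show ?thesis by (simp add: window_kernel_def dirichlet_sum_def)
qed

lemma norm_window_kernel_minus: "norm (window_kernel H J (- t)) = norm (window_kernel H J t)"
proof -
  have c: "dirichlet_sum K (- s) = cnj (dirichlet_sum K s)" for K s
    by (simp add: dirichlet_sum_def cnj_ee)
  show ?thesis by (simp add: window_kernel_def norm_mult norm_divide c)
qed

text \<open>
  Each \<open>n \<le> N\<close> is \<open>i - j\<close> with \<open>i = n + j < N + J\<close> for every \<open>j < J\<close>, so averaging over \<open>j\<close> recovers it
  with full weight.
\<close>

lemma sum_le_window_average: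
  fixes F :: "int \<Rightarrow> real"
  assumes "\<And>n. F n \<ge> 0" "T \<subseteq> {..N}" "J > 0"
  shows "(\<Sum>n\<in>T. F (int n)) \<le> (\<Sum>i<N + J. \<Sum>j<J. F (int i - int j)) / real J"
proof -
  have fin: "finite T" using assms(2) finite_subset by blast
  have "real J * (\<Sum>n\<in>T. F (int n)) = (\<Sum>j<J. \<Sum>n\<in>T. F (int n))" by simp
  also have "\<dots> \<le> (\<Sum>j<J. \<Sum>i<N + J. F (int i - int j))"
  proof (rule sum_mono)
    fix j assume j: "j \<in> {..<J}"
    have "(\<Sum>n\<in>T. F (int n)) = (\<Sum>i\<in>(\<lambda>n. n + j) ` T. F (int i - int j))"
      by (subst sum.reindex) (auto intro: inj_onI)
    also have "\<dots> \<le> (\<Sum>i<N + J. F (int i - int j))"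
      using assms(1,2) j by (intro sum_mono2) auto
    finally show "(\<Sum>n\<in>T. F (int n)) \<le> (\<Sum>i<N + J. F (int i - int j))" .
  qed
  also have "\<dots> = (\<Sum>i<N + J. \<Sum>j<J. F (int i - int j))" by (rule sum.swap)
  finally show ?thesis using assms(3) by (simp add: field_simps)
qed

text \<open>
  Opening the square turns the average into a quadratic form whose matrix is the kernel.
\<close>

lemma window_average_le:
  fixes k :: "'i \<Rightarrow> complex"
  assumes "finite I"
  shows "(\<Sum>i<H. \<Sum>j<J. (norm (\<Sum>x\<in>I. k x * ee (of_int (int i - int j) * \<theta> x)))\<^sup>2) / real J
    \<le> (\<Sum>x\<in>I. \<Sum>y\<in>I. norm (k x) * norm (k y) * norm (window_kernel H J (\<theta> x - \<theta> y)))"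
proof -
  let ?S = "\<lambda>n::int. \<Sum>x\<in>I. k x * ee (of_int n * \<theta> x)"
  have S: "of_real ((norm (?S n))\<^sup>2) = (\<Sum>x\<in>I. \<Sum>y\<in>I. k x * cnj (k y) * ee (of_int n * (\<theta> x - \<theta> y)))"
    for n
  proof -
    have "of_real ((norm (?S n))\<^sup>2) = ?S n * cnj (?S n)" by (rule complex_norm_square)
    also have "\<dots> = (\<Sum>x\<in>I. \<Sum>y\<in>I. (k x * ee (of_int n * \<theta> x)) * (cnj (k y) * ee (- (of_int n * \<theta> y))))"
      by (simp add: sum_product cnj_ee)
    also have "\<dots> = (\<Sum>x\<in>I. \<Sum>y\<in>I. k x * cnj (k y) * ee (of_int n * (\<theta> x - \<theta> y)))"
    proof (intro sum.cong refl)
      fix x y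
      have "ee (of_int n * (\<theta> x - \<theta> y)) = ee (of_int n * \<theta> x) * ee (- (of_int n * \<theta> y))"
        by (simp add: right_diff_distrib flip: ee_add)
      then show "(k x * ee (of_int n * \<theta> x)) * (cnj (k y) * ee (- (of_int n * \<theta> y)))
          = k x * cnj (k y) * ee (of_int n * (\<theta> x - \<theta> y))" by simp
    qed
    finally show ?thesis .
  qed
  have W: "(\<Sum>i<H. \<Sum>j<J. ee (of_int (int i - int j) * t)) / of_nat J = window_kernel H J t" for t
  proof -
    have "ee (of_int (int i - int j) * t) = ee (of_nat i * t) * ee (of_nat j * (- t))" for i j
      by (simp add: left_diff_distrib flip: ee_add)
    then show ?thesis by (simp add: window_kernel_def dirichlet_sum_def sum_product)
  qed
  let ?L = "(\<Sum>i<H. \<Sum>j<J. (norm (?S (int i - int j)))\<^sup>2) / real J"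
  have "(\<Sum>i<H. \<Sum>j<J. \<Sum>x\<in>I. \<Sum>y\<in>I. k x * cnj (k y) * ee (of_int (int i - int j) * (\<theta> x - \<theta> y)))
      = (\<Sum>x\<in>I. \<Sum>y\<in>I. \<Sum>i<H. \<Sum>j<J. k x * cnj (k y) * ee (of_int (int i - int j) * (\<theta> x - \<theta> y)))"
    (is "?A = ?B")
  proof -
    have "?A = (\<Sum>i<H. \<Sum>x\<in>I. \<Sum>j<J. \<Sum>y\<in>I. k x * cnj (k y) * ee (of_int (int i - int j) * (\<theta> x - \<theta> y)))"
      by (intro sum.cong refl sum.swap)
    also have "\<dots> = (\<Sum>i<H. \<Sum>x\<in>I. \<Sum>y\<in>I. \<Sum>j<J. k x * cnj (k y) * ee (of_int (int i - int j) * (\<theta> x - \<theta> y)))"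
      by (intro sum.cong refl sum.swap)
    also have "\<dots> = (\<Sum>x\<in>I. \<Sum>i<H. \<Sum>y\<in>I. \<Sum>j<J. k x * cnj (k y) * ee (of_int (int i - int j) * (\<theta> x - \<theta> y)))"
      by (rule sum.swap)
    also have "\<dots> = ?B"
      by (intro sum.cong refl sum.swap)
    finally show ?thesis .
  qed
  then have "of_real ?L = ?B / of_nat J" by (simp only: of_real_divide of_real_sum S of_real_of_nat_eq)
  also have "\<dots> = (\<Sum>x\<in>I. \<Sum>y\<in>I. k x * cnj (k y) * window_kernel H J (\<theta> x - \<theta> y))"
    by (simp only: W [symmetric] sum_divide_distrib sum_distrib_left times_divide_eq_right)
  finally have "norm (of_real ?L :: complex)
      = norm (\<Sum>x\<in>I. \<Sum>y\<in>I. k x * cnj (k y) * window_kernel H J (\<theta> x - \<theta> y))" by simp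
  also have "\<dots> \<le> (\<Sum>x\<in>I. \<Sum>y\<in>I. norm (k x) * norm (k y) * norm (window_kernel H J (\<theta> x - \<theta> y)))"
    by (intro order.trans[OF norm_sum] sum_mono) (simp add: norm_mult)
  also have "norm (of_real ?L :: complex) = ?L"
    by (simp only: norm_of_real) (simp add: sum_nonneg)
  finally show ?thesis .
qed

text \<open>
  Schur's test: the kernel is symmetric in absolute value and its row sums are bounded.
\<close>

lemma schur_window_kernel_le:
  assumes "finite B" "spaced \<delta> B u" "\<delta> > 0"
  shows "(\<Sum>x\<in>B. \<Sum>y\<in>B. norm (f x) * norm (f y) * norm (window_kernel H J (u x - u y)))
    \<le> (real H + 5 / (6 * real J * \<delta>\<^sup>2)) * (\<Sum>x\<in>B. (norm (f x))\<^sup>2)"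
proof -
  let ?W = "\<lambda>x y. norm (window_kernel H J (u x - u y))" and ?C = "real H + 5 / (6 * real J * \<delta>\<^sup>2)"
  have row: "(\<Sum>x\<in>B. ?W x y) \<le> ?C" if "y \<in> B" for y
  proof -
    have "{x\<in>B. int_dist (u x - u y) < \<delta>} \<subseteq> {y}"
      using assms(2) that by (fastforce simp: spaced_def)
    then have "card {x\<in>B. int_dist (u x - u y) < \<delta>} \<le> 1"
      using card_mono[of "{y}"] by fastforce
    from sum_window_kernel_spaced_le[OF assms this] show ?thesis by simp
  qed
  have sym: "?W x y = ?W y x" for x y
    using norm_window_kernel_minus[of H J "u x - u y"] by simp
  have "(\<Sum>x\<in>B. \<Sum>y\<in>B. norm (f x) * norm (f y) * ?W x y)
      \<le> (\<Sum>x\<in>B. \<Sum>y\<in>B. (norm (f x))\<^sup>2 * ?W x y / 2 + (norm (f y))\<^sup>2 * ?W x y / 2)"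
  proof (intro sum_mono)
    fix x y
    have "norm (f x) * norm (f y) \<le> ((norm (f x))\<^sup>2 + (norm (f y))\<^sup>2) / 2"
      using sum_squares_bound[of "norm (f x)" "norm (f y)"] by simp
    then have "norm (f x) * norm (f y) * ?W x y \<le> ((norm (f x))\<^sup>2 + (norm (f y))\<^sup>2) / 2 * ?W x y"
      by (intro mult_right_mono) auto
    then show "norm (f x) * norm (f y) * ?W x y
        \<le> (norm (f x))\<^sup>2 * ?W x y / 2 + (norm (f y))\<^sup>2 * ?W x y / 2"
      by (simp add: algebra_simps add_divide_distrib)
  qed
  also have "\<dots> = (\<Sum>x\<in>B. \<Sum>y\<in>B. (norm (f x))\<^sup>2 * ?W x y / 2)
      + (\<Sum>x\<in>B. \<Sum>y\<in>B. (norm (f y))\<^sup>2 * ?W x y / 2)"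
    by (simp add: sum.distrib)
  also have "(\<Sum>x\<in>B. \<Sum>y\<in>B. (norm (f y))\<^sup>2 * ?W x y / 2) = (\<Sum>x\<in>B. \<Sum>y\<in>B. (norm (f x))\<^sup>2 * ?W x y / 2)"
    by (subst sum.swap) (simp add: sym)
  also have "(\<Sum>x\<in>B. \<Sum>y\<in>B. (norm (f x))\<^sup>2 * ?W x y / 2) + (\<Sum>x\<in>B. \<Sum>y\<in>B. (norm (f x))\<^sup>2 * ?W x y / 2)
      = (\<Sum>x\<in>B. (norm (f x))\<^sup>2 * (\<Sum>y\<in>B. ?W y x))"
    by (simp add: sum_distrib_left sym flip: sum.distrib)
  also have "\<dots> \<le> (\<Sum>x\<in>B. (norm (f x))\<^sup>2 * ?C)"
    using row by (intro sum_mono mult_left_mono) auto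
  also have "\<dots> = ?C * (\<Sum>x\<in>B. (norm (f x))\<^sup>2)" 
    by (subst mult.commute, rule sum_distrib_right [symmetric])
  finally show ?thesis .
qed

lemma large_sieve_window:
  assumes "finite B" "spaced \<delta> B u" "\<delta> > 0" "T \<subseteq> {..N}" "J > 0"
  shows "(\<Sum>n\<in>T. (norm (\<Sum>b\<in>B. f b * ee (of_nat n * u b)))\<^sup>2)
    \<le> (real (N + J) + 5 / (6 * real J * \<delta>\<^sup>2)) * (\<Sum>b\<in>B. (norm (f b))\<^sup>2)"
proof -
  have "(\<Sum>n\<in>T. (norm (\<Sum>b\<in>B. f b * ee (of_nat n * u b)))\<^sup>2)
      \<le> (\<Sum>i<N + J. \<Sum>j<J. (norm (\<Sum>b\<in>B. f b * ee (of_int (int i - int j) * u b)))\<^sup>2) / real J"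
    using sum_le_window_average[of "\<lambda>n. (norm (\<Sum>b\<in>B. f b * ee (of_int n * u b)))\<^sup>2" T N J] assms(4,5)
    by simp
  also have "\<dots> \<le> (\<Sum>x\<in>B. \<Sum>y\<in>B. norm (f x) * norm (f y) * norm (window_kernel (N + J) J (u x - u y)))"
    by (rule window_average_le[OF assms(1)])
  also have "\<dots> \<le> (real (N + J) + 5 / (6 * real J * \<delta>\<^sup>2)) * (\<Sum>x\<in>B. (norm (f x))\<^sup>2)"
    by (rule schur_window_kernel_le[OF assms(1-3)])
  finally show ?thesis .
qed

section \<open>The Selberg weight\<close>

text \<open>
  Partial fractions are unique: after multiplication by the product of the other primes, all terms
  but the one at \<open>p\<close> become divisible by \<open>p\<close>.
\<close>

lemma sum_fractions_Ints_imp_dvd: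
  fixes P :: "nat set" and d :: "nat \<Rightarrow> int"
  assumes "finite P" "\<And>p. p \<in> P \<Longrightarrow> prime p"
    and "(\<Sum>q\<in>P. real_of_int (d q) / real q) \<in> \<int>" "p \<in> P"
  shows "int p dvd d p"
proof -
  define R where "R = (\<Prod>q\<in>P - {p}. q)"
  obtain m :: int where m: "(\<Sum>q\<in>P. real_of_int (d q) / real q) = of_int m"
    using assms(3) by (auto elim: Ints_cases)
  have pos: "real q > 0" if "q \<in> P" for q using assms(2)[OF that] prime_gt_0_nat by simp
  have "real_of_int (d p) / real p = of_int m - (\<Sum>q\<in>P - {p}. real_of_int (d q) / real q)"
    using m assms(1,4) by (simp add: sum.remove)
  then have "real_of_int (d p) * real R
      = real p * (of_int m * real R - (\<Sum>q\<in>P - {p}. real_of_int (d q) / real q) * real R)"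
    (is "_ = _ * (_ - ?s * _)")
    using pos[OF assms(4)] by (simp only: divide_eq_eq) (simp add: algebra_simps)
  also have "?s * real R = (\<Sum>q\<in>P - {p}. real_of_int (d q) / real q * real R)"
    by (rule sum_distrib_right)
  also have "(\<Sum>q\<in>P - {p}. real_of_int (d q) / real q * real R)
      = (\<Sum>q\<in>P - {p}. real_of_int (d q * int (R div q)))"
  proof (rule sum.cong)
    fix q assume q: "q \<in> P - {p}"
    then have "q dvd R" unfolding R_def using assms(1) by (intro dvd_prodI) auto
    then have "real R = real q * real (R div q)" by (simp flip: of_nat_mult)
    then show "real_of_int (d q) / real q * real R = real_of_int (d q * int (R div q))"
      using pos[of q] q by simp
  qed simp
  finally have "real_of_int (d p * int R)
      = real_of_int (int p * (m * int R - (\<Sum>q\<in>P - {p}. d q * int (R div q))))"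
    by simp
  then have "d p * int R = int p * (m * int R - (\<Sum>q\<in>P - {p}. d q * int (R div q)))"
    by (simp only: of_int_eq_iff)
  then have "int p dvd d p * int R" by simp
  moreover have "coprime (int p) (int R)"
    unfolding coprime_int_iff R_def
    using assms(2,4) by (intro prod_coprime_right) (auto simp: primes_coprime)
  ultimately show ?thesis by (simp add: coprime_dvd_mult_left_iff)
qed

text \<open>
  The reduced fractions \<open>a/q\<close> modulo 1, with squarefree \<open>q \<le> z\<close> composed of sieving primes, are
  encoded by partial fractions: a residue \<open>a p < p\<close> for every \<open>p \<in> P\<close> stands for the point
  \<open>\<Sum> a p / p\<close>, and \<open>q\<close> is the product of the support of \<open>a\<close>.  Sums over such vectors factor over
  the primes, and the component at a given prime can be read off directly.  The coefficient of the
  character at \<open>a\<close> is \<open>\<mu>(q)/\<phi>(q)\<close>; its absolute value is \<open>weight a\<close>.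
\<close>

locale prime_sieve =
  fixes P :: "nat set" and z :: real
  assumes finite_P: "finite P" and prime_P: "p \<in> P \<Longrightarrow> prime p" and z_ge_1: "z \<ge> 1"
begin

definition support :: "(nat \<Rightarrow> nat) \<Rightarrow> nat set" where
  "support a = {p\<in>P. a p \<noteq> 0}"

definition fractions :: "(nat \<Rightarrow> nat) set" where
  "fractions = {a \<in> PiE P (\<lambda>p. {..<p}). support a \<in> sieve_sets P z}"

definition point :: "(nat \<Rightarrow> nat) \<Rightarrow> real" where
  "point a = (\<Sum>p\<in>P. real (a p) / real p)"

definition weight :: "(nat \<Rightarrow> nat) \<Rightarrow> real" where
  "weight a = (\<Prod>p\<in>support a. 1 / (real p - 1))"

definition sieve_poly :: "int \<Rightarrow> complex" where
  "sieve_poly n = (\<Sum>a\<in>fractions. of_real ((-1) ^ card (support a) * weight a) * ee (of_int n * point a))"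

lemma P_gt_1: "p \<in> P \<Longrightarrow> real p > 1"
  using prime_P[of p] prime_gt_1_nat by simp

lemma finite_fractions [simp]: "finite fractions"
proof -
  have "finite (PiE P (\<lambda>p. {..<p}))" using finite_P by (intro finite_PiE) auto
  then show ?thesis by (rule finite_subset[rotated]) (auto simp: fractions_def)
qed

lemma support_subset: "support a \<subseteq> P" by (auto simp: support_def)

lemma finite_support [simp]: "finite (support a)"
  using support_subset finite_P by (rule finite_subset)

lemma weight_pos: "weight a > 0"
  unfolding weight_def using P_gt_1 support_subset by (intro prod_pos) fastforce

lemma fraction_lt: "a \<in> fractions \<Longrightarrow> p \<in> P \<Longrightarrow> a p < p"
  by (auto simp: fractions_def dest: PiE_mem)

lemma fractions_with_support:
  assumes "Q \<in> sieve_sets P z"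
  shows "{a \<in> fractions. support a = Q} = PiE P (\<lambda>p. if p \<in> Q then {1..<p} else {0})"
    (is "?L = ?R")
proof (intro equalityI subsetI)
  fix a assume "a \<in> ?L"
  then show "a \<in> ?R"
    by (auto simp: fractions_def support_def PiE_iff)
next
  fix a assume a: "a \<in> ?R"
  have Q: "Q \<subseteq> P" using assms by (simp add: sieve_sets_def)
  have m: "a p \<in> (if p \<in> Q then {1..<p} else {0})" if "p \<in> P" for p using a that by (rule PiE_mem)
  have "support a = Q"
    using m Q by (fastforce simp: support_def split: if_splits)
  moreover have "a \<in> PiE P (\<lambda>p. {..<p})"
  proof (rule PiE_I)
    fix p assume "p \<in> P"
    then show "a p \<in> {..<p}" using m[of p] P_gt_1[of p] by (auto split: if_splits)
  qed (use a in \<open>auto simp: PiE_iff extensional_def\<close>)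
  ultimately show "a \<in> ?L" using assms by (simp add: fractions_def)
qed

lemma sum_fractions_by_support:
  fixes F :: "(nat \<Rightarrow> nat) \<Rightarrow> 'b :: comm_monoid_add"
  shows "(\<Sum>a\<in>fractions. F a) = (\<Sum>Q\<in>sieve_sets P z. \<Sum>a | a \<in> fractions \<and> support a = Q. F a)"
proof (rule sum.group [symmetric])
  show "support ` fractions \<subseteq> sieve_sets P z" by (auto simp: fractions_def)
qed (use finite_P in simp_all)

text \<open>
  There are \<open>\<phi>(q)\<close> fractions with denominator \<open>q\<close>, each with squared weight \<open>1/\<phi>(q)\<^sup>2\<close>.
\<close>

lemma sum_weight_squares: "(\<Sum>a\<in>fractions. (weight a)\<^sup>2) = sieve_sum P z"
  unfolding sum_fractions_by_support sieve_sum_def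
proof (rule sum.cong)
  fix Q assume Q: "Q \<in> sieve_sets P z"
  then have QP: "Q \<subseteq> P" by (simp add: sieve_sets_def)
  define w where "w = (\<Prod>p\<in>Q. 1 / (real p - 1))"
  have "card {a \<in> fractions. support a = Q} = (\<Prod>p\<in>P. if p \<in> Q then p - 1 else 1)"
    unfolding fractions_with_support[OF Q] using finite_P
    by (subst card_PiE) (auto intro!: prod.cong)
  also have "\<dots> = (\<Prod>p\<in>Q. p - 1)"
    using finite_P QP by (simp add: prod.If_cases Int_absorb1)
  finally have "card {a \<in> fractions. support a = Q} = (\<Prod>p\<in>Q. p - 1)" .
  moreover have "real (p - 1) = real p - 1" if "p \<in> Q" for p
    using prime_ge_1_nat[OF prime_P, of p] that QP by (subst of_nat_diff) auto
  ultimately have "real (card {a \<in> fractions. support a = Q}) = (\<Prod>p\<in>Q. real p - 1)"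
    by simp
  also have "(\<Prod>p\<in>Q. real p - 1) = 1 / w"
    by (simp add: w_def prod_dividef)
  finally have card: "real (card {a \<in> fractions. support a = Q}) = 1 / w" .
  have "w > 0" unfolding w_def using QP P_gt_1 by (intro prod_pos) fastforce
  have "(\<Sum>a | a \<in> fractions \<and> support a = Q. (weight a)\<^sup>2) = (\<Sum>a | a \<in> fractions \<and> support a = Q. w\<^sup>2)"
    by (intro sum.cong) (auto simp: weight_def w_def)
  also have "\<dots> = w" using \<open>w > 0\<close> by (simp add: card power2_eq_square)
  finally show "(\<Sum>a | a \<in> fractions \<and> support a = Q. (weight a)\<^sup>2) = (\<Prod>p\<in>Q. 1 / (real p - 1))"
    by (simp add: w_def)
qed simp

lemma sum_nonzero_residues:
  assumes "prime p" "\<not> int p dvd n"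
  shows "(\<Sum>r=1..<p. ee (of_int n * (real r / real p))) = -1"
proof -
  have p: "real p > 0" "p \<ge> 1" using assms(1) prime_gt_0_nat[of p] by auto
  let ?\<omega> = "ee (of_int n / real p)"
  have "?\<omega> \<noteq> 1"
  proof
    assume "?\<omega> = 1"
    then obtain m :: int where "of_int n / real p = of_int m" using ee_eq_1_imp_Ints Ints_cases by metis
    then have "real_of_int n = real_of_int (int p * m)" using p by (simp add: field_simps)
    then have "n = int p * m" by (simp only: of_int_eq_iff)
    then show False using assms(2) by simp
  qed
  moreover have "?\<omega> ^ p = 1"
  proof -
    have "?\<omega> ^ p = ee (of_int n)" using p by (simp flip: ee_power)
    also have "\<dots> = ee 0" by (rule ee_cong) simp
    finally show ?thesis by simp
  qed
  ultimately have "(\<Sum>r<p. ?\<omega> ^ r) = 0" by (simp add: sum_gp_strict)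
  moreover have "(\<Sum>r<p. ?\<omega> ^ r) = 1 + (\<Sum>r=1..<p. ?\<omega> ^ r)"
    using p(2) by (simp add: lessThan_atLeast0 sum.atLeast_Suc_lessThan)
  moreover have "?\<omega> ^ r = ee (of_int n * (real r / real p))" for r
    by (simp add: mult.commute flip: ee_power)
  ultimately show ?thesis by (simp add: add_eq_0_iff)
qed

text \<open>
  For \<open>n\<close> coprime to \<open>q\<close> the Ramanujan sum of the characters with denominator \<open>q\<close> is \<open>\<mu>(q)\<close>, which
  cancels the sign of the coefficient, so that every \<open>q\<close> contributes \<open>1/\<phi>(q)\<close>.
\<close>

lemma sieve_poly_coprime:
  assumes "\<And>p. p \<in> P \<Longrightarrow> \<not> int p dvd n"
  shows "sieve_poly n = of_real (sieve_sum P z)"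
proof -
  have "(\<Sum>a | a \<in> fractions \<and> support a = Q.
        of_real ((-1) ^ card (support a) * weight a) * ee (of_int n * point a))
      = of_real (\<Prod>p\<in>Q. 1 / (real p - 1))" if Q: "Q \<in> sieve_sets P z" for Q
  proof -
    from Q have QP: "Q \<subseteq> P" by (simp add: sieve_sets_def)
    let ?A = "\<lambda>p. if p \<in> Q then {1..<p} else {0}"
    have "(\<Sum>a | a \<in> fractions \<and> support a = Q. ee (of_int n * point a))
        = (\<Sum>a\<in>PiE P ?A. \<Prod>p\<in>P. ee (of_int n * (real (a p) / real p)))"
      unfolding fractions_with_support[OF Q] point_def
      by (simp add: sum_distrib_left ee_sum)
    also have "\<dots> = (\<Prod>p\<in>P. \<Sum>r\<in>?A p. ee (of_int n * (real r / real p)))"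
      using finite_P by (intro prod_sum_PiE [symmetric]) auto
    also have "\<dots> = (\<Prod>p\<in>P. if p \<in> Q then -1 else 1)"
      using sum_nonzero_residues[OF prime_P assms] by (intro prod.cong) auto
    also have "\<dots> = (-1) ^ card Q"
      using finite_P QP by (simp add: prod.If_cases Int_absorb1)
    finally have E: "(\<Sum>a | a \<in> fractions \<and> support a = Q. ee (of_int n * point a)) = (-1) ^ card Q" .
    have "(\<Sum>a | a \<in> fractions \<and> support a = Q.
        of_real ((-1) ^ card (support a) * weight a) * ee (of_int n * point a))
      = of_real ((-1) ^ card Q * (\<Prod>p\<in>Q. 1 / (real p - 1)))
        * (\<Sum>a | a \<in> fractions \<and> support a = Q. ee (of_int n * point a))"
      unfolding sum_distrib_left by (intro sum.cong) (auto simp: weight_def)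
    also have "\<dots> = of_real (\<Prod>p\<in>Q. 1 / (real p - 1))"
      unfolding E by (simp add: power_mult_distrib [symmetric] flip: power_add)
    finally show ?thesis .
  qed
  then show ?thesis
    by (simp add: sieve_poly_def sum_fractions_by_support sieve_sum_def)
qed

lemma sieve_sum_ge_1: "sieve_sum P z \<ge> 1"
proof -
  have "(\<Prod>p\<in>{}. 1 / (real p - 1)) \<le> sieve_sum P z"
    unfolding sieve_sum_def
  proof (rule member_le_sum)
    show "{} \<in> sieve_sets P z" using z_ge_1 by (simp add: sieve_sets_def)
    fix Q assume "Q \<in> sieve_sets P z - {{}}"
    then show "0 \<le> (\<Prod>p\<in>Q. 1 / (real p - 1))"
      using P_gt_1 by (intro prod_nonneg) (fastforce simp: sieve_sets_def)
  qed (use finite_P in simp)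
  then show ?thesis by simp
qed

text \<open>
  Erasing the component at \<open>p\<close> is injective on vectors with a prescribed nonzero residue there; it
  multiplies the squared weight by \<open>(p-1)\<^sup>2\<close> and can only decrease the denominator.
\<close>

lemma sum_weight_squares_residue:
  assumes "p \<in> P" "r \<noteq> 0"
  shows "(\<Sum>a | a \<in> fractions \<and> a p = r. (weight a)\<^sup>2) \<le> sieve_sum P z / (real p - 1)\<^sup>2"
proof -
  let ?F = "{a \<in> fractions. a p = r}" and ?s = "\<lambda>a. a(p := (0::nat))"
  have supp: "support (?s a) = support a - {p}" for a by (auto simp: support_def)
  have w: "(weight a)\<^sup>2 = (weight (?s a))\<^sup>2 / (real p - 1)\<^sup>2" if "a \<in> ?F" for a
  proof -
    have "p \<in> support a" using that assms by (auto simp: support_def)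
    then have "weight a = 1 / (real p - 1) * weight (?s a)"
      by (simp add: weight_def supp prod.remove)
    then show ?thesis by (simp add: power_divide)
  qed
  have inj: "inj_on ?s ?F"
    by (rule inj_onI) (metis (mono_tags, lifting) fun_upd_triv fun_upd_upd mem_Collect_eq)
  have sub: "?s ` ?F \<subseteq> fractions"
  proof (rule image_subsetI)
    fix a assume a: "a \<in> ?F"
    then have "a \<in> PiE P (\<lambda>p. {..<p})" and S: "support a \<in> sieve_sets P z" by (auto simp: fractions_def)
    then have "?s a \<in> PiE P (\<lambda>p. {..<p})"
      using assms(1) P_gt_1[of p] by (auto simp: PiE_iff extensional_def)
    moreover have "\<Prod>(support a - {p}) \<le> \<Prod>(support a)"
    proof (rule dvd_imp_le)
      show "\<Prod>(support a - {p}) dvd \<Prod>(support a)" by (rule prod_dvd_prod_subset) auto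
      show "0 < \<Prod>(support a)"
        using prime_P support_subset[of a] by (intro prod_pos) (auto intro!: prime_gt_0_nat)
    qed
    then have "real (\<Prod>(support a - {p})) \<le> z"
      using S unfolding sieve_sets_def by (metis (mono_tags, lifting) mem_Collect_eq of_nat_mono order.trans)
    ultimately show "?s a \<in> fractions"
      using support_subset[of a] by (auto simp: fractions_def supp sieve_sets_def)
  qed
  have "(\<Sum>a\<in>?F. (weight a)\<^sup>2) = (\<Sum>a\<in>?F. (weight (?s a))\<^sup>2) / (real p - 1)\<^sup>2"
    unfolding sum_divide_distrib using w by (intro sum.cong) auto
  also have "(\<Sum>a\<in>?F. (weight (?s a))\<^sup>2) = (\<Sum>a\<in>?s ` ?F. (weight a)\<^sup>2)"
    using inj by (simp add: sum.reindex)
  also have "\<dots> \<le> sieve_sum P z"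
    unfolding sum_weight_squares [symmetric] using sub by (intro sum_mono2) auto
  finally show ?thesis by (simp add: divide_right_mono)
qed

lemma sum_weight_squares_support:
  assumes "p \<in> P"
  shows "(\<Sum>a | a \<in> fractions \<and> a p \<noteq> 0. (weight a)\<^sup>2) \<le> sieve_sum P z / (real p - 1)"
proof -
  let ?F = "{a \<in> fractions. a p \<noteq> 0}"
  have "(\<Sum>a\<in>?F. (weight a)\<^sup>2) = (\<Sum>r\<in>{1..<p}. \<Sum>a | a \<in> ?F \<and> a p = r. (weight a)\<^sup>2)"
    using fraction_lt assms by (intro sum.group [symmetric]) (auto simp: Suc_le_eq)
  also have "\<dots> = (\<Sum>r\<in>{1..<p}. \<Sum>a | a \<in> fractions \<and> a p = r. (weight a)\<^sup>2)"
    by (intro sum.cong) auto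
  also have "\<dots> \<le> (\<Sum>r\<in>{1..<p}. sieve_sum P z / (real p - 1)\<^sup>2)"
    using assms by (intro sum_mono sum_weight_squares_residue) auto
  also have "\<dots> = sieve_sum P z / (real p - 1)"
    using P_gt_1[OF assms] by (simp add: of_nat_diff power2_eq_square)
  finally show ?thesis .
qed

lemma point_difference_component:
  assumes "(point a - point b) - (point c - point d) \<in> \<int>" "p \<in> P"
  shows "int p dvd (int (a p) - int (b p)) - (int (c p) - int (d p))"
proof (rule sum_fractions_Ints_imp_dvd[OF finite_P prime_P _ assms(2)])
  have "(\<Sum>q\<in>P. real_of_int ((int (a q) - int (b q)) - (int (c q) - int (d q))) / real q)
      = (point a - point b) - (point c - point d)"
    by (simp add: point_def diff_divide_distrib sum_subtractf)
  then show "(\<Sum>q\<in>P. real_of_int ((int (a q) - int (b q)) - (int (c q) - int (d q))) / real q) \<in> \<int>"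
    using assms(1) by simp
qed

lemma point_inj:
  assumes "a \<in> fractions" "b \<in> fractions" "point a - point b \<in> \<int>"
  shows "a = b"
proof -
  have "a p = b p" if p: "p \<in> P" for p
  proof -
    have "int p dvd int (a p) - int (b p)"
      using point_difference_component[of a b b b p] assms(3) p by simp
    then have "int (a p) mod int p = int (b p) mod int p" by (simp add: mod_eq_dvd_iff)
    then show ?thesis using fraction_lt[OF assms(1) p] fraction_lt[OF assms(2) p] by simp
  qed
  then show ?thesis
    using assms(1,2) by (intro PiE_ext[of a P "\<lambda>p. {..<p}" b]) (auto simp: fractions_def)
qed

lemma point_denominator:
  assumes "a \<in> fractions"
  obtains k :: int and D :: nat where "D > 0" "real D \<le> z" "point a * real D = of_int k"
proof
  let ?D = "\<Prod>(support a)"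
  show "?D > 0"
    using prime_P support_subset[of a] by (intro prod_pos) (auto intro!: prime_gt_0_nat)
  show "real ?D \<le> z" using assms by (auto simp: fractions_def sieve_sets_def)
  have "point a = (\<Sum>p\<in>support a. real (a p) / real p)"
    unfolding point_def using finite_P by (intro sum.mono_neutral_right) (auto simp: support_def)
  then have "point a * real ?D = (\<Sum>p\<in>support a. real (a p) / real p * real ?D)"
    by (simp only: sum_distrib_right)
  also have "\<dots> = (\<Sum>p\<in>support a. real_of_int (int (a p) * int (?D div p)))"
  proof (rule sum.cong)
    fix p assume p: "p \<in> support a"
    then have "real p > 0" using P_gt_1[of p] support_subset by fastforce
    have "p dvd ?D" using p dvd_prodI[of "support a" p "\<lambda>x. x"] by simp
    then have "real ?D = real p * real (?D div p)" by (metis dvd_mult_div_cancel of_nat_mult)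
    then show "real (a p) / real p * real ?D = real_of_int (int (a p) * int (?D div p))"
      using \<open>real p > 0\<close> by simp
  qed simp
  finally show "point a * real ?D = of_int (\<Sum>p\<in>support a. int (a p) * int (?D div p))" by simp
qed

text \<open>
  The four denominators are at most \<open>z\<close>, so the number in question is a multiple of \<open>1/D\<close> for some
  \<open>D \<le> z\<^sup>4\<close>.
\<close>

lemma point_difference_spacing:
  assumes "a \<in> fractions" "b \<in> fractions" "c \<in> fractions" "d \<in> fractions"
    and "(point a - point b) - (point c - point d) \<notin> \<int>"
  shows "1 / z ^ 4 \<le> int_dist ((point a - point b) - (point c - point d))"
proof -
  let ?t = "(point a - point b) - (point c - point d)"
  obtain ka and Da :: nat where a: "Da > 0" "real Da \<le> z" "point a * real Da = of_int ka"
    using point_denominator[OF assms(1)] by blast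
  obtain kb and Db :: nat where b: "Db > 0" "real Db \<le> z" "point b * real Db = of_int kb"
    using point_denominator[OF assms(2)] by blast
  obtain kc and Dc :: nat where c: "Dc > 0" "real Dc \<le> z" "point c * real Dc = of_int kc"
    using point_denominator[OF assms(3)] by blast
  obtain kd and Dd :: nat where d: "Dd > 0" "real Dd \<le> z" "point d * real Dd = of_int kd"
    using point_denominator[OF assms(4)] by blast
  define D where "D = Da * Db * (Dc * Dd)"
  have D: "real D > 0" using a b c d by (simp add: D_def)
  have "real D \<le> z * z * (z * z)"
    unfolding D_def of_nat_mult using a b c d z_ge_1 by (intro mult_mono) auto
  then have Dz: "real D \<le> z ^ 4" by (simp add: power4_eq_xxxx)
  have "?t * real D = (point a * real Da) * real (Db * (Dc * Dd)) - (point b * real Db) * real (Da * (Dc * Dd))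
      - ((point c * real Dc) * real (Da * Db * Dd) - (point d * real Dd) * real (Da * Db * Dc))"
    by (simp add: D_def algebra_simps)
  also have "\<dots> \<in> \<int>" unfolding a(3) b(3) c(3) d(3) by (intro Ints_diff Ints_mult) auto
  finally have tD: "?t * real D \<in> \<int>" .
  obtain k :: int where k: "int_dist ?t = \<bar>?t - of_int k\<bar>" using int_dist_attained by blast
  have "?t * real D - of_int k * real D \<in> \<int>" by (rule Ints_diff[OF tD]) simp
  then have "(?t - of_int k) * real D \<in> \<int>" by (simp only: left_diff_distrib)
  moreover have "?t - of_int k \<noteq> 0" using assms(5) by auto
  then have "(?t - of_int k) * real D \<noteq> 0" using D by simp
  ultimately have "1 \<le> \<bar>(?t - of_int k) * real D\<bar>" by (rule Ints_nonzero_abs_ge1)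
  then have "1 \<le> int_dist ?t * real D" using D k by (simp add: abs_mult)
  then have "1 / real D \<le> int_dist ?t" using D by (simp add: field_simps)
  moreover have "1 / z ^ 4 \<le> 1 / real D" using D Dz by (intro frac_le) auto
  ultimately show ?thesis by linarith
qed

text \<open>
  Here \<open>E\<close> is a set of pairs that all represent the same nonzero frequency \<open>y\<close>, so the sum bounds the
  coefficient of \<open>y\<close> in \<open>|h|\<^sup>2\<close>.  Choose a prime \<open>p\<close> at which \<open>y\<close> has a nonzero component.  In each
  pair the components at \<open>p\<close> differ by a fixed nonzero residue.  If one of them vanishes, the other
  is prescribed; prescribing a nonzero residue costs a factor \<open>(p-1)\<^sup>2\<close> in the sum of squared
  weights, whence \<open>1/(p-1)\<close> by Cauchy--Schwarz.  If neither vanishes, both sums of squares have lost a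
  factor \<open>p - 1\<close>.  The three cases give \<open>3G/(p-1)\<close>.
\<close>

lemma sum_weight_products_le:
  assumes "E \<subseteq> fractions \<times> fractions" "\<And>e. e \<in> E \<Longrightarrow> fst e \<noteq> snd e"
    and rep: "\<And>e e'. e \<in> E \<Longrightarrow> e' \<in> E \<Longrightarrow>
      (point (fst e) - point (snd e)) - (point (fst e') - point (snd e')) \<in> \<int>"
    and "\<kappa> > 0" "\<And>p. p \<in> P \<Longrightarrow> \<kappa> \<le> real p - 1"
  shows "(\<Sum>e\<in>E. weight (fst e) * weight (snd e)) \<le> 3 * sieve_sum P z / \<kappa>"
proof (cases "E = {}")
  case True
  then show ?thesis using sieve_sum_ge_1 assms(4) by simp
next
  case False
  then obtain b where b: "b \<in> E" by auto
  define G where "G = sieve_sum P z"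
  have G: "G \<ge> 0" using sieve_sum_ge_1 by (simp add: G_def)
  have finE: "finite E" using assms(1) by (rule finite_subset) simp
  have mem: "fst e \<in> fractions" "snd e \<in> fractions" if "e \<in> E" for e
    using subsetD[OF assms(1) that] by (simp_all add: mem_Times_iff)
  \<comment> \<open>Given the frequency, either component of a pair determines the other.\<close>
  have inj_fst: "inj_on fst E"
  proof (rule inj_onI)
    fix e e' assume e: "e \<in> E" "e' \<in> E" "fst e = fst e'"
    have "point (snd e') - point (snd e) \<in> \<int>" using rep[OF e(1,2)] e(3) by simp
    then have "snd e' = snd e" using mem e by (intro point_inj) auto
    then show "e = e'" using e(3) by (simp add: prod_eq_iff)
  qed
  have inj_snd: "inj_on snd E"
  proof (rule inj_onI)
    fix e e' assume e: "e \<in> E" "e' \<in> E" "snd e = snd e'"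
    have "point (fst e) - point (fst e') \<in> \<int>" using rep[OF e(1,2)] e(3) by simp
    then have "fst e = fst e'" using mem e by (intro point_inj) auto
    then show "e = e'" using e(3) by (simp add: prod_eq_iff)
  qed
  have "\<exists>p\<in>P. fst b p \<noteq> snd b p"
    using PiE_ext[of "fst b" P "\<lambda>p. {..<p}" "snd b"] mem[OF b] assms(2)[OF b]
    by (auto simp: fractions_def)
  then obtain p where p: "p \<in> P" "fst b p \<noteq> snd b p" by auto
  have p1: "real p > 1" using P_gt_1[OF p(1)] .
  define s where "s = (int (fst b p) - int (snd b p)) mod int p"
  define s' where "s' = (int (snd b p) - int (fst b p)) mod int p"
  have cong: "(int (fst e p) - int (snd e p)) mod int p = s"
    "(int (snd e p) - int (fst e p)) mod int p = s'" if e: "e \<in> E" for e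
  proof -
    have d: "int p dvd (int (fst e p) - int (snd e p)) - (int (fst b p) - int (snd b p))"
      by (rule point_difference_component[OF rep[OF e b] p(1)])
    then show "(int (fst e p) - int (snd e p)) mod int p = s" by (simp add: s_def mod_eq_dvd_iff)
    from d have "int p dvd - ((int (fst e p) - int (snd e p)) - (int (fst b p) - int (snd b p)))"
      by (simp only: dvd_minus_iff)
    then have "int p dvd (int (snd e p) - int (fst e p)) - (int (snd b p) - int (fst b p))"
      by (simp add: algebra_simps)
    then show "(int (snd e p) - int (fst e p)) mod int p = s'" by (simp add: s'_def mod_eq_dvd_iff)
  qed
  have lt: "fst e p < p" "snd e p < p" if "e \<in> E" for e
    using fraction_lt mem[OF that] p(1) by auto
  have s0: "s \<noteq> 0" "s' \<noteq> 0"
  proof -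
    have "fst b p mod p \<noteq> snd b p mod p" using lt[OF b] p(2) by simp
    then have "int (fst b p) mod int p \<noteq> int (snd b p) mod int p" by (simp flip: of_nat_mod)
    then show "s \<noteq> 0" "s' \<noteq> 0"
      unfolding s_def s'_def by (auto simp: mod_eq_dvd_iff dvd_diff_commute dvd_eq_mod_eq_0 [symmetric])
  qed
  have "s \<ge> 0" "s' \<ge> 0" using p1 by (simp_all add: s_def s'_def)
  then have s_pos: "nat s \<noteq> 0" "nat s' \<noteq> 0" using s0 by auto
  have ne: "fst e p \<noteq> snd e p" if "e \<in> E" for e
    using cong(1)[OF that] s0(1) by auto
  define E1 where "E1 = {e\<in>E. snd e p = 0}"
  define E2 where "E2 = {e\<in>E. fst e p = 0}"
  define E3 where "E3 = {e\<in>E. fst e p \<noteq> 0 \<and> snd e p \<noteq> 0}"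
  have sub: "E1 \<subseteq> E" "E2 \<subseteq> E" "E3 \<subseteq> E" by (auto simp: E1_def E2_def E3_def)
  have fins: "finite E1" "finite E2" "finite E3" using sub finE finite_subset by blast+
  have squares: "(\<Sum>e\<in>E'. (weight (g e))\<^sup>2) \<le> (\<Sum>a\<in>S. (weight a)\<^sup>2)"
    if "inj_on g E" "E' \<subseteq> E" "g ` E' \<subseteq> S" "S \<subseteq> fractions" for g E' S
  proof -
    have "(\<Sum>e\<in>E'. (weight (g e))\<^sup>2) = (\<Sum>a\<in>g ` E'. (weight a)\<^sup>2)"
      using inj_on_subset[OF that(1,2)] by (simp add: sum.reindex)
    also have "\<dots> \<le> (\<Sum>a\<in>S. (weight a)\<^sup>2)"
      using that(3) finite_subset[OF that(4)] by (intro sum_mono2) auto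
    finally show ?thesis .
  qed
  have full: "(\<Sum>e\<in>E'. (weight (g e))\<^sup>2) \<le> G" if "inj_on g E" "E' \<subseteq> E" "g ` E' \<subseteq> fractions" for g E'
    using squares[OF that] by (simp add: sum_weight_squares G_def)
  have fixed: "(\<Sum>e\<in>E'. (weight (g e))\<^sup>2) \<le> G / (real p - 1)\<^sup>2"
    if "inj_on g E" "E' \<subseteq> E" "g ` E' \<subseteq> {a \<in> fractions. a p = r}" "r \<noteq> 0" for g E' r
    using squares[OF that(1-3)] sum_weight_squares_residue[OF p(1) that(4)] by (simp add: G_def)
  have nonzero: "(\<Sum>e\<in>E'. (weight (g e))\<^sup>2) \<le> G / (real p - 1)"
    if "inj_on g E" "E' \<subseteq> E" "g ` E' \<subseteq> {a \<in> fractions. a p \<noteq> 0}" for g E'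
    using squares[OF that(1-3)] sum_weight_squares_support[OF p(1)] by (simp add: G_def)
  \<comment> \<open>Cauchy--Schwarz in the form that balances the two sums of squares.\<close>
  have amgm: "x * y \<le> ((real p - 1) * x\<^sup>2 + y\<^sup>2 / (real p - 1)) / 2" for x y
  proof -
    have "0 \<le> ((real p - 1) * x - y)\<^sup>2 / (real p - 1)" using p1 by simp
    also have "\<dots> = (real p - 1) * x\<^sup>2 + y\<^sup>2 / (real p - 1) - 2 * (x * y)"
      using p1 by (simp add: power2_eq_square field_simps)
    finally show ?thesis by simp
  qed
  have split_sum: "(\<Sum>e\<in>E'. weight (g e) * weight (h e)) \<le> G / (real p - 1)"
    if "(\<Sum>e\<in>E'. (weight (g e))\<^sup>2) \<le> G / (real p - 1)\<^sup>2" "(\<Sum>e\<in>E'. (weight (h e))\<^sup>2) \<le> G" for g h E'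
  proof -
    have "(\<Sum>e\<in>E'. weight (g e) * weight (h e))
        \<le> (\<Sum>e\<in>E'. ((real p - 1) * (weight (g e))\<^sup>2 + (weight (h e))\<^sup>2 / (real p - 1)) / 2)"
      by (intro sum_mono amgm)
    also have "\<dots> = ((real p - 1) * (\<Sum>e\<in>E'. (weight (g e))\<^sup>2) + (\<Sum>e\<in>E'. (weight (h e))\<^sup>2) / (real p - 1)) / 2"
      by (simp add: sum.distrib sum_distrib_left sum_divide_distrib add_divide_distrib)
    also have "\<dots> \<le> ((real p - 1) * (G / (real p - 1)\<^sup>2) + G / (real p - 1)) / 2"
      using that p1 by (intro divide_right_mono add_mono mult_left_mono) auto
    also have "(real p - 1) * (G / (real p - 1)\<^sup>2) = G / (real p - 1)"
      using p1 by (simp add: power2_eq_square)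
    finally show ?thesis by (simp only: add_divide_distrib field_sum_of_halves)
  qed
  have 1: "(\<Sum>e\<in>E1. weight (fst e) * weight (snd e)) \<le> G / (real p - 1)"
  proof (rule split_sum)
    have "fst e p = nat s" if "e \<in> E1" for e
      using cong(1)[of e] lt(1)[of e] that by (auto simp: E1_def)
    then show "(\<Sum>e\<in>E1. (weight (fst e))\<^sup>2) \<le> G / (real p - 1)\<^sup>2"
      using sub mem s_pos by (intro fixed[OF inj_fst, of E1 "nat s"]) auto
    show "(\<Sum>e\<in>E1. (weight (snd e))\<^sup>2) \<le> G"
      using sub mem by (intro full[OF inj_snd]) auto
  qed
  have "(\<Sum>e\<in>E2. weight (snd e) * weight (fst e)) \<le> G / (real p - 1)"
  proof (rule split_sum)
    have "snd e p = nat s'" if "e \<in> E2" for e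
      using cong(2)[of e] lt(2)[of e] that by (auto simp: E2_def)
    then show "(\<Sum>e\<in>E2. (weight (snd e))\<^sup>2) \<le> G / (real p - 1)\<^sup>2"
      using sub mem s_pos by (intro fixed[OF inj_snd, of E2 "nat s'"]) auto
    show "(\<Sum>e\<in>E2. (weight (fst e))\<^sup>2) \<le> G"
      using sub mem by (intro full[OF inj_fst]) auto
  qed
  then have 2: "(\<Sum>e\<in>E2. weight (fst e) * weight (snd e)) \<le> G / (real p - 1)"
    by (simp add: mult.commute)
  have 3: "(\<Sum>e\<in>E3. weight (fst e) * weight (snd e)) \<le> G / (real p - 1)"
  proof -
    have "(\<Sum>e\<in>E3. weight (fst e) * weight (snd e))
        \<le> (\<Sum>e\<in>E3. ((weight (fst e))\<^sup>2 + (weight (snd e))\<^sup>2) / 2)"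
    proof (rule sum_mono)
      fix e show "weight (fst e) * weight (snd e) \<le> ((weight (fst e))\<^sup>2 + (weight (snd e))\<^sup>2) / 2"
        using sum_squares_bound[of "weight (fst e)" "weight (snd e)"] by simp
    qed
    also have "\<dots> = ((\<Sum>e\<in>E3. (weight (fst e))\<^sup>2) + (\<Sum>e\<in>E3. (weight (snd e))\<^sup>2)) / 2"
      by (simp add: sum.distrib flip: sum_divide_distrib)
    also have "\<dots> \<le> (G / (real p - 1) + G / (real p - 1)) / 2"
      using sub mem by (intro divide_right_mono add_mono nonzero inj_fst inj_snd) (auto simp: E3_def)
    finally show ?thesis by (simp only: add_divide_distrib field_sum_of_halves)
  qed
  have disj: "E1 \<inter> (E2 \<union> E3) = {}" "E2 \<inter> E3 = {}"
    using ne by (fastforce simp: E1_def E2_def E3_def)+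
  have "E = E1 \<union> (E2 \<union> E3)" by (auto simp: E1_def E2_def E3_def)
  then have "(\<Sum>e\<in>E. weight (fst e) * weight (snd e))
      = (\<Sum>e\<in>E1 \<union> (E2 \<union> E3). weight (fst e) * weight (snd e))" by simp
  also have "\<dots> = (\<Sum>e\<in>E1. weight (fst e) * weight (snd e))
      + ((\<Sum>e\<in>E2. weight (fst e) * weight (snd e)) + (\<Sum>e\<in>E3. weight (fst e) * weight (snd e)))"
    using fins disj by (simp add: sum.union_disjoint)
  also have "\<dots> \<le> 3 * G / (real p - 1)" using 1 2 3 by simp
  also have "\<dots> \<le> 3 * G / \<kappa>"
    using assms(4) assms(5)[OF p(1)] G by (intro divide_left_mono mult_pos_pos) auto
  finally show ?thesis by (simp add: G_def)
qed

text \<open>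
  Pairs are grouped by the frequency \<open>y\<close> that they represent modulo 1.  Distinct frequencies are
  \<open>z\<^bsup>-4\<^esup>\<close>-spaced, so the kernel is summable over them, whatever the shift \<open>\<phi>\<close>.
\<close>

lemma off_diagonal_kernel_le:
  assumes "\<kappa> > 0" "\<And>p. p \<in> P \<Longrightarrow> \<kappa> \<le> real p - 1"
  shows "(\<Sum>e | e \<in> fractions \<times> fractions \<and> fst e \<noteq> snd e.
      weight (fst e) * weight (snd e) * norm (window_kernel H J (\<phi> + (point (fst e) - point (snd e)))))
    \<le> 3 * sieve_sum P z / \<kappa> * (2 * real H + 5 * z ^ 8 / (6 * real J))"
proof -
  define D where "D = {e \<in> fractions \<times> fractions. fst e \<noteq> snd e}"
  define t where "t e = point (fst e) - point (snd e)" for e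
  define g where "g e = frac (t e)" for e
  have finD: "finite D" by (simp add: D_def)
  have g: "g e - t e \<in> \<int>" for e by (simp add: g_def frac_def)
  have same: "t e - t e' \<in> \<int>" if "g e = g e'" for e e'
  proof -
    have "t e - t e' = (g e' - t e') - (g e - t e)" using that by simp
    then show ?thesis using Ints_diff[OF g[of e'] g[of e]] by simp
  qed
  have spaced: "spaced (1 / z ^ 4) (g ` D) (\<lambda>y. y)"
    unfolding spaced_def
  proof (clarify)
    fix a a' b b' assume D: "(a, a') \<in> D" "(b, b') \<in> D" and ne: "g (a, a') \<noteq> g (b, b')"
    have "(g (a, a') - g (b, b')) - (t (a, a') - t (b, b')) \<in> \<int>"
      using Ints_diff[OF g[of "(a, a')"] g[of "(b, b')"]] by (simp add: algebra_simps)
    then have eq: "int_dist (g (a, a') - g (b, b')) = int_dist (t (a, a') - t (b, b'))"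
      by (rule int_dist_cong)
    have "t (a, a') - t (b, b') \<notin> \<int>"
    proof
      assume "t (a, a') - t (b, b') \<in> \<int>"
      then obtain m :: int where "t (a, a') - t (b, b') = of_int m" by (elim Ints_cases)
      then have "t (a, a') = t (b, b') + of_int m" by simp
      then have "frac (t (a, a')) = frac (t (b, b'))" by (simp add: frac_def)
      then show False using ne by (simp add: g_def)
    qed
    then show "1 / z ^ 4 \<le> int_dist (g (a, a') - g (b, b'))"
      unfolding eq using D point_difference_spacing[of a a' b b'] by (simp add: D_def t_def)
  qed
  have "(\<Sum>e\<in>D. weight (fst e) * weight (snd e) * norm (window_kernel H J (\<phi> + t e)))
      = (\<Sum>y\<in>g ` D. \<Sum>e | e \<in> D \<and> g e = y. weight (fst e) * weight (snd e) * norm (window_kernel H J (\<phi> + t e)))"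
    using finD by (intro sum.group [symmetric]) auto
  also have "\<dots> = (\<Sum>y\<in>g ` D. norm (window_kernel H J (y - (- \<phi>)))
      * (\<Sum>e | e \<in> D \<and> g e = y. weight (fst e) * weight (snd e)))"
  proof (intro sum.cong refl)
    fix y
    have "window_kernel H J (\<phi> + t e) = window_kernel H J (y - (- \<phi>))" if "g e = y" for e
    proof (rule window_kernel_cong)
      show "\<phi> + t e - (y - (- \<phi>)) \<in> \<int>" using Ints_minus[OF g[of e]] that by simp
    qed
    then show "(\<Sum>e | e \<in> D \<and> g e = y. weight (fst e) * weight (snd e) * norm (window_kernel H J (\<phi> + t e)))
        = norm (window_kernel H J (y - (- \<phi>))) * (\<Sum>e | e \<in> D \<and> g e = y. weight (fst e) * weight (snd e))"
      unfolding sum_distrib_left by (intro sum.cong) auto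
  qed
  also have "\<dots> \<le> (\<Sum>y\<in>g ` D. norm (window_kernel H J (y - (- \<phi>))) * (3 * sieve_sum P z / \<kappa>))"
  proof (intro sum_mono mult_left_mono sum_weight_products_le assms)
    fix y e e' assume "e \<in> {e \<in> D. g e = y}" "e' \<in> {e \<in> D. g e = y}"
    then show "point (fst e) - point (snd e) - (point (fst e') - point (snd e')) \<in> \<int>"
      using same[of e e'] by (simp add: t_def)
  qed (auto simp: D_def)
  also have "\<dots> = 3 * sieve_sum P z / \<kappa> * (\<Sum>y\<in>g ` D. norm (window_kernel H J (y - (- \<phi>))))"
    by (subst mult.commute, rule sum_distrib_right [symmetric])
  also have "\<dots> \<le> 3 * sieve_sum P z / \<kappa> * (2 * real H + 5 * z ^ 8 / (6 * real J))"
  proof (rule mult_left_mono)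
    have z4: "1 / z ^ 4 > 0" using z_ge_1 by simp
    have "(\<Sum>y\<in>g ` D. norm (window_kernel H J (y - (- \<phi>)))) \<le> real 2 * real H + 5 / (6 * real J * (1 / z ^ 4)\<^sup>2)"
      using finD by (intro sum_window_kernel_spaced_le[OF _ spaced z4] card_spaced_near_le[OF _ spaced z4]) auto
    also have "5 / (6 * real J * (1 / z ^ 4)\<^sup>2) = 5 * z ^ 8 / (6 * real J)"
      by (simp add: power_divide flip: power_mult)
    finally show "(\<Sum>y\<in>g ` D. norm (window_kernel H J (y - (- \<phi>)))) \<le> 2 * real H + 5 * z ^ 8 / (6 * real J)"
      by simp
    show "0 \<le> 3 * sieve_sum P z / \<kappa>" using sieve_sum_ge_1 assms(1) by simp
  qed
  finally show ?thesis by (simp add: D_def t_def)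
qed

text \<open>
  Multiplying \<open>S(n)\<close> by \<open>h(n)\<close> leaves \<open>G S(n)\<close> on the sifted set \<open>T\<close>, so the window average may be
  applied to the product \<open>h S\<close>, whose frequencies are the shifts of the points of \<open>B\<close> by the sieve
  fractions.  Pairs of equal fractions reproduce the large sieve quadratic form with the
  factor \<open>\<Sum> weight\<^sup>2 = G\<close>; for unequal fractions the spacing of \<open>B\<close> is of no help, and
  \<open>f\<close> enters only through its sum of absolute values.
\<close>

lemma sieved_large_sieve:
  fixes u :: "'b \<Rightarrow> real" and f :: "'b \<Rightarrow> complex"
  assumes "finite B" "spaced \<delta> B u" "\<delta> > 0" "T \<subseteq> {..N}" "J > 0"
    and "\<And>n p. n \<in> T \<Longrightarrow> p \<in> P \<Longrightarrow> \<not> p dvd n"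
    and "\<kappa> > 0" "\<And>p. p \<in> P \<Longrightarrow> \<kappa> \<le> real p - 1"
  shows "sieve_sum P z * (\<Sum>n\<in>T. (norm (\<Sum>b\<in>B. f b * ee (of_nat n * u b)))\<^sup>2)
    \<le> (real (N + J) + 5 / (6 * real J * \<delta>\<^sup>2)) * (\<Sum>b\<in>B. (norm (f b))\<^sup>2)
      + 3 / \<kappa> * (2 * real (N + J) + 5 * z ^ 8 / (6 * real J)) * (\<Sum>b\<in>B. norm (f b))\<^sup>2"
proof -
  define G where "G = sieve_sum P z"
  have G: "G \<ge> 1" using sieve_sum_ge_1 by (simp add: G_def)
  define S where "S n = (\<Sum>b\<in>B. f b * ee (of_int n * u b))" for n
  define H where "H = N + J"
  let ?W = "\<lambda>t. norm (window_kernel H J t)"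
  define C1 where "C1 = real H + 5 / (6 * real J * \<delta>\<^sup>2)"
  define C2 where "C2 = 2 * real H + 5 * z ^ 8 / (6 * real J)"
  define k where "k x = of_real ((-1) ^ card (support (fst x)) * weight (fst x)) * f (snd x)" for x
  define \<theta> where "\<theta> x = point (fst x) + u (snd x)" for x
  have prod: "sieve_poly n * S n = (\<Sum>x\<in>fractions \<times> B. k x * ee (of_int n * \<theta> x))" for n
    unfolding sieve_poly_def S_def sum_product sum.cartesian_product k_def \<theta>_def
    by (intro sum.cong) (auto simp: distrib_left ee_add mult_ac)
  have nk: "norm (k x) = weight (fst x) * norm (f (snd x))" for x
    using weight_pos[of "fst x"] by (simp add: k_def norm_mult norm_power)
  have "G\<^sup>2 * (\<Sum>n\<in>T. (norm (\<Sum>b\<in>B. f b * ee (of_nat n * u b)))\<^sup>2)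
      = (\<Sum>n\<in>T. (norm (\<Sum>x\<in>fractions \<times> B. k x * ee (of_int (int n) * \<theta> x)))\<^sup>2)"
    unfolding sum_distrib_left
  proof (rule sum.cong)
    fix n assume "n \<in> T"
    then have "sieve_poly (int n) = of_real G"
      unfolding G_def using assms(6) by (intro sieve_poly_coprime) (simp add: int_dvd_int_iff)
    then have "norm (\<Sum>x\<in>fractions \<times> B. k x * ee (of_int (int n) * \<theta> x)) = G * norm (S (int n))"
      unfolding prod [symmetric] using G by (simp add: norm_mult)
    then show "G\<^sup>2 * (norm (\<Sum>b\<in>B. f b * ee (of_nat n * u b)))\<^sup>2
        = (norm (\<Sum>x\<in>fractions \<times> B. k x * ee (of_int (int n) * \<theta> x)))\<^sup>2"
      by (simp add: S_def power_mult_distrib)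
  qed simp
  also have "\<dots> \<le> (\<Sum>i<H. \<Sum>j<J. (norm (\<Sum>x\<in>fractions \<times> B. k x * ee (of_int (int i - int j) * \<theta> x)))\<^sup>2) / real J"
    unfolding H_def
    by (rule sum_le_window_average[of "\<lambda>n. (norm (\<Sum>x\<in>fractions \<times> B. k x * ee (of_int n * \<theta> x)))\<^sup>2", OF _ assms(4,5)]) simp
  also have "\<dots> \<le> (\<Sum>x\<in>fractions \<times> B. \<Sum>y\<in>fractions \<times> B. norm (k x) * norm (k y) * ?W (\<theta> x - \<theta> y))"
    using assms(1) by (intro window_average_le) simp
  also have "\<dots> = (\<Sum>a\<in>fractions. \<Sum>b\<in>B. \<Sum>a'\<in>fractions. \<Sum>b'\<in>B.
      weight a * norm (f b) * (weight a' * norm (f b')) * ?W (point a + u b - (point a' + u b')))"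
    by (simp add: sum.cartesian_product' nk \<theta>_def)
  also have "\<dots> = (\<Sum>b\<in>B. \<Sum>b'\<in>B. \<Sum>a\<in>fractions. \<Sum>a'\<in>fractions.
      weight a * norm (f b) * (weight a' * norm (f b')) * ?W (point a + u b - (point a' + u b')))"
    (is "?L = ?R")
  proof -
    have "?L = (\<Sum>a\<in>fractions. \<Sum>b\<in>B. \<Sum>b'\<in>B. \<Sum>a'\<in>fractions.
      weight a * norm (f b) * (weight a' * norm (f b')) * ?W (point a + u b - (point a' + u b')))"
      by (intro sum.cong refl sum.swap)
    also have "\<dots> = (\<Sum>b\<in>B. \<Sum>a\<in>fractions. \<Sum>b'\<in>B. \<Sum>a'\<in>fractions.
      weight a * norm (f b) * (weight a' * norm (f b')) * ?W (point a + u b - (point a' + u b')))"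
      by (rule sum.swap)
    also have "\<dots> = ?R" by (intro sum.cong refl sum.swap)
    finally show ?thesis .
  qed
  also have "\<dots> \<le> (\<Sum>b\<in>B. \<Sum>b'\<in>B. norm (f b) * norm (f b') * (G * ?W (u b - u b') + 3 * G / \<kappa> * C2))"
  proof (intro sum_mono)
    fix b b'
    let ?\<phi> = "u b - u b'"
    let ?h = "\<lambda>e. weight (fst e) * weight (snd e) * ?W (?\<phi> + (point (fst e) - point (snd e)))"
    let ?X = "fractions \<times> fractions"
    have "(\<Sum>a\<in>fractions. \<Sum>a'\<in>fractions.
        weight a * norm (f b) * (weight a' * norm (f b')) * ?W (point a + u b - (point a' + u b')))
      = norm (f b) * norm (f b') * (\<Sum>e\<in>?X. ?h e)"
      by (simp add: sum.cartesian_product' sum_distrib_left algebra_simps)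
    also have "(\<Sum>e\<in>?X. ?h e) = (\<Sum>e | e \<in> ?X \<and> fst e = snd e. ?h e) + (\<Sum>e | e \<in> ?X \<and> fst e \<noteq> snd e. ?h e)"
      by (subst sum.union_disjoint [symmetric]) (auto intro!: sum.cong)
    also have "(\<Sum>e | e \<in> ?X \<and> fst e = snd e. ?h e) = (\<Sum>a\<in>fractions. (weight a)\<^sup>2 * ?W ?\<phi>)"
    proof -
      have "{e. e \<in> ?X \<and> fst e = snd e} = (\<lambda>a. (a, a)) ` fractions" by auto
      then show ?thesis by (simp add: sum.reindex inj_on_def power2_eq_square)
    qed
    also have "\<dots> = G * ?W ?\<phi>" by (simp add: G_def flip: sum_distrib_right sum_weight_squares)
    also have "(\<Sum>e | e \<in> ?X \<and> fst e \<noteq> snd e. ?h e) \<le> 3 * G / \<kappa> * C2"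
      unfolding G_def C2_def by (rule off_diagonal_kernel_le[OF assms(7,8)])
    finally show "(\<Sum>a\<in>fractions. \<Sum>a'\<in>fractions.
        weight a * norm (f b) * (weight a' * norm (f b')) * ?W (point a + u b - (point a' + u b')))
      \<le> norm (f b) * norm (f b') * (G * ?W ?\<phi> + 3 * G / \<kappa> * C2)"
      by (simp add: mult_left_mono)
  qed
  also have "\<dots> = G * ((\<Sum>b\<in>B. \<Sum>b'\<in>B. norm (f b) * norm (f b') * ?W (u b - u b'))
      + 3 / \<kappa> * C2 * (\<Sum>b\<in>B. norm (f b))\<^sup>2)"
    by (simp add: power2_eq_square sum_product sum_distrib_left sum.distrib algebra_simps)
  also have "\<dots> \<le> G * (C1 * (\<Sum>b\<in>B. (norm (f b))\<^sup>2) + 3 / \<kappa> * C2 * (\<Sum>b\<in>B. norm (f b))\<^sup>2)"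
    using G schur_window_kernel_le[OF assms(1-3), of f H J] by (intro mult_left_mono) (auto simp: C1_def)
  finally have "G * (G * (\<Sum>n\<in>T. (norm (\<Sum>b\<in>B. f b * ee (of_nat n * u b)))\<^sup>2))
      \<le> G * (C1 * (\<Sum>b\<in>B. (norm (f b))\<^sup>2) + 3 / \<kappa> * C2 * (\<Sum>b\<in>B. norm (f b))\<^sup>2)"
    by (simp add: power2_eq_square mult.assoc)
  then show ?thesis using G by (simp add: G_def C1_def C2_def H_def)
qed

end

section \<open>Exponential sums over primes\<close>

lemma exp_seven_eighths_le: "exp (7 / 8) \<le> (242 / 100 :: real)"
proof (rule power_le_imp_le_base)
  have "exp (7 / 8 :: real) ^ Suc 7 = exp 1 ^ 7"
    by (simp flip: exp_of_nat_mult)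
  also have "\<dots> \<le> (272 / 100) ^ 7"
    using e_less_272 by (intro power_mono) auto
  also have "\<dots> \<le> (242 / 100) ^ Suc 7" by (simp add: power_divide)
  finally show "exp (7 / 8 :: real) ^ Suc 7 \<le> (242 / 100) ^ Suc 7" .
qed simp

text \<open>
  The case \<open>x = (2K)\<^sup>6\<close>, \<open>L = log (2K)\<close>, of the Mertens product; the exponent 6 comes out of balancing this
  bound, which grows with the exponent, against the off-diagonal term, which decreases with it.
\<close>

lemma mertens_product_at_power_le:
  assumes "L \<ge> ln 2"
  shows "(\<Prod>p | prime p \<and> real p \<le> exp (6 * L). real p / (real p - 1)) \<le> 33 * L"
proof -
  have L: "L \<ge> 2 / 3" using assms ln2_ge_two_thirds by linarith
  have "(3 * ln 2 + 1) / (2 * (6 * L)) \<le> 3 / 8"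
  proof -
    have "3 * ln 2 + 1 \<le> 3 * L + 3 / 2 * L" using assms L by linarith
    then show ?thesis using L by (simp add: divide_simps)
  qed
  then have "exp (1 / 2 + (3 * ln 2 + 1) / (2 * (6 * L))) \<le> exp (7 / 8)" by simp
  then have e: "exp (1 / 2 + (3 * ln 2 + 1) / (2 * (6 * L))) \<le> 242 / 100"
    using exp_seven_eighths_le by linarith
  have "(\<Prod>p | prime p \<and> real p \<le> exp (6 * L). real p / (real p - 1))
      \<le> (1 + 2 * (6 * L)) * exp (1 / 2 + (3 * ln 2 + 1) / (2 * (6 * L)))"
    using mertens_product_le[of "exp (6 * L)"] L by simp
  also have "\<dots> \<le> (27 / 2 * L) * (242 / 100)"
    using L e by (intro mult_mono) auto
  also have "\<dots> \<le> 33 * L" using L by simp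
  finally show ?thesis .
qed

lemma sum_squares_le_square_sum:
  fixes g :: "'b \<Rightarrow> real"
  assumes "\<And>b. b \<in> B \<Longrightarrow> g b \<ge> 0"
  shows "(\<Sum>b\<in>B. (g b)\<^sup>2) \<le> (\<Sum>b\<in>B. g b)\<^sup>2"
  using assms
proof (induction B rule: infinite_finite_induct)
  case (insert x B)
  have "0 \<le> g x * (\<Sum>b\<in>B. g b)" using insert by (intro mult_nonneg_nonneg sum_nonneg) auto
  moreover have "(\<Sum>b\<in>B. (g b)\<^sup>2) \<le> (\<Sum>b\<in>B. g b)\<^sup>2" using insert by simp
  ultimately show ?case using insert by (simp add: power2_sum)
qed auto

text \<open>
  With \<open>J\<close> close to \<open>3M/4\<close> the large sieve constant stays below \<open>15M/8\<close> for all proportions of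
  \<open>N\<close> and \<open>1/\<delta>\<close>.  The second bound is the analogous constant for points of spacing \<open>1/N\<close>, up to two
  of which may be near the centre.
\<close>

lemma window_length_bounds:
  fixes N \<delta> :: real
  assumes "N \<ge> 1000" "\<delta> > 0" and M: "M = N + inverse \<delta>" and J: "J = nat \<lceil>3 / 4 * M\<rceil>"
  shows "J > 0"
    and "real (nat \<lfloor>N\<rfloor> + J) + 5 / (6 * real J * \<delta>\<^sup>2) \<le> 15 / 8 * M"
    and "2 * real (nat \<lfloor>N\<rfloor> + J) + 5 * N\<^sup>2 / (6 * real J) \<le> 37 / 8 * M"
proof -
  define x where "x = inverse \<delta>"
  have x: "x > 0" and Mx: "M = N + x" using assms by (auto simp: x_def)
  have J1: "3 / 4 * M \<le> real J" "real J \<le> 3 / 4 * M + 1"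
    using assms(1) x Mx unfolding J by linarith+
  then show J0: "J > 0" using assms(1) x Mx by (cases "J = 0") auto
  have n: "real (nat \<lfloor>N\<rfloor>) \<le> N" using assms(1) by simp
  have M0: "M > 0" using assms(1) x Mx by simp
  have quot: "5 * y\<^sup>2 / (6 * real J) \<le> 10 / 9 * y" if "0 \<le> y" "y \<le> M" for y
  proof -
    have "5 * y\<^sup>2 / (6 * real J) \<le> 5 * y\<^sup>2 / (6 * (3 / 4 * M))"
      using J1(1) J0 M0 by (intro divide_left_mono) auto
    also have "\<dots> = 10 / 9 * (y\<^sup>2 / M)" by simp
    also have "\<dots> \<le> 10 / 9 * y"
      using that M0 by (intro mult_left_mono) (auto simp: divide_simps power2_eq_square intro: mult_left_mono)
    finally show ?thesis .
  qed
  have "5 / (6 * real J * \<delta>\<^sup>2) = 5 * x\<^sup>2 / (6 * real J)"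
    by (simp add: x_def field_simps)
  then have "5 / (6 * real J * \<delta>\<^sup>2) \<le> 10 / 9 * x" using quot[of x] x Mx assms(1) by simp
  then show "real (nat \<lfloor>N\<rfloor> + J) + 5 / (6 * real J * \<delta>\<^sup>2) \<le> 15 / 8 * M"
    using n J1 x Mx assms(1) unfolding of_nat_add by linarith
  have "5 * N\<^sup>2 / (6 * real J) \<le> 10 / 9 * N" using quot[of N] x Mx assms(1) by simp
  moreover have "2 * real (nat \<lfloor>N\<rfloor> + J) \<le> 2 * N + 3 / 2 * M + 2"
    using add_mono[OF n J1(2)] by simp
  moreover have "2 * N + 3 / 2 * M + 2 + 10 / 9 * N \<le> 37 / 8 * M" using x Mx assms(1) by linarith
  ultimately show "2 * real (nat \<lfloor>N\<rfloor> + J) + 5 * N\<^sup>2 / (6 * real J) \<le> 37 / 8 * M"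
    by (meson add_mono order.trans)
qed

text \<open>
  If \<open>log N\<close> is at most a large multiple of \<open>log (2K)\<close>, the large sieve over all integers suffices.
  Otherwise primes in \<open>(z, N]\<close> are sifted, and primes up to \<open>z\<close> are bounded trivially by
  \<open>z \<parallel>f\<parallel>\<^sub>1\<^sup>2\<close>, which is at most \<open>\<surd>N \<parallel>f\<parallel>\<^sub>2\<^sup>2\<close> in that range.  The constant 280 splits as
  \<open>278 + 2\<close>, and \<open>278 \<ge> 4 \<cdot> 33 \<cdot> 2.1\<close>, where 4 comes from \<open>z = N\<^bsup>1/4\<^esup>\<close>, 33 from the
  Mertens product and 2.1 from the large sieve constants.
\<close>

lemma sum_primes_exponential_square_le:
  fixes N \<delta> :: real and u :: "'b \<Rightarrow> real" and f :: "'b \<Rightarrow> complex"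
  assumes N: "N \<ge> 1000" and \<delta>: "\<delta> > 0" and B: "finite B" "spaced \<delta> B u"
    and F2_pos: "(\<Sum>b\<in>B. (norm (f b))\<^sup>2) > 0"
  defines "F1 \<equiv> (\<Sum>b\<in>B. norm (f b))" and "F2 \<equiv> (\<Sum>b\<in>B. (norm (f b))\<^sup>2)"
  shows "(\<Sum>p | prime p \<and> real p \<le> N. (norm (\<Sum>b\<in>B. f b * ee (of_nat p * u b)))\<^sup>2)
    \<le> 280 * (N + inverse \<delta>) * F2 * (ln (2 * F1\<^sup>2 / F2) / ln N)"
proof -
  define S where "S n = (norm (\<Sum>b\<in>B. f b * ee (of_nat n * u b)))\<^sup>2" for n
  define M where "M = N + inverse \<delta>"
  define J where "J = nat \<lceil>3 / 4 * M\<rceil>"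
  define n where "n = nat \<lfloor>N\<rfloor>"
  define K where "K = F1\<^sup>2 / F2"
  define L where "L = ln (2 * K)"
  note J = window_length_bounds[OF N \<delta> M_def J_def, folded n_def]
  have F2: "F2 > 0" using F2_pos by (simp add: F2_def)
  have M: "M \<ge> N" using \<delta> by (simp add: M_def)
  then have M_pos: "M > 0" using N by linarith
  have MF: "M * F2 > 0" using M_pos F2 by simp
  have "F2 \<le> F1\<^sup>2" unfolding F1_def F2_def by (rule sum_squares_le_square_sum) simp
  then have K: "K \<ge> 1" using F2 by (simp add: K_def)
  have F1: "F1\<^sup>2 = K * F2" using F2 by (simp add: K_def)
  have L: "L \<ge> ln 2" using K by (simp add: L_def)
  then have L23: "L \<ge> 2 / 3" using ln2_ge_two_thirds by linarith
  have lnN: "ln N > 0" using N by simp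
  have upto: "{p. prime p \<and> real p \<le> N} \<subseteq> {..n}" by (auto simp: n_def le_nat_floor)
  have "(\<Sum>p | prime p \<and> real p \<le> N. S p) \<le> 280 * M * F2 * (L / ln N)"
  proof (cases "15 / 8 * ln N \<le> 280 * L")
    case True
    have "(\<Sum>p | prime p \<and> real p \<le> N. S p) \<le> (real (n + J) + 5 / (6 * real J * \<delta>\<^sup>2)) * F2"
      unfolding S_def F2_def by (rule large_sieve_window[OF B \<delta> upto J(1)])
    also have "\<dots> \<le> 15 / 8 * M * F2" using J(2) F2 by (intro mult_right_mono) auto
    also have "\<dots> = (M * F2) * (15 / 8)" by simp
    also have "\<dots> \<le> (M * F2) * (280 * L / ln N)"
      using True lnN MF by (intro mult_left_mono) (auto simp: divide_simps)
    finally show ?thesis by (simp add: mult_ac)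
  next
    case False
    then have big: "149 * L \<le> ln N" using L23 by linarith
    define z where "z = N powr (1 / 4)"
    define w where "w = exp (6 * L)"
    define P where "P = {p::nat. prime p \<and> w < real p \<and> real p \<le> z}"
    define T where "T = {p::nat. prime p \<and> real p \<le> N \<and> z < real p}"
    define G where "G = sieve_sum P z"
    have z: "z \<ge> 1" using N by (simp add: z_def ge_one_powr_ge_zero)
    have z2: "z\<^sup>2 = sqrt N" using N by (simp add: z_def powr_powr powr_half_sqrt flip: powr_numeral)
    have z8: "z ^ 8 = N\<^sup>2" using N by (simp add: z_def powr_powr flip: powr_numeral)
    have lnz: "ln z = ln N / 4" using N by (simp add: z_def ln_powr)
    interpret prime_sieve P z
    proof
      show "finite P" unfolding P_def by (rule finite_subset[OF _ finite_primes_le[of z]]) auto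
    qed (use z in \<open>auto simp: P_def\<close>)
    have G1: "G \<ge> 1" using sieve_sum_ge_1 by (simp add: G_def)
    have w: "w - 1 \<ge> 63 * K"
    proof -
      have "w = exp L ^ 6" by (simp add: w_def flip: exp_of_nat_mult)
      also have "exp L = 2 * K" using K by (simp add: L_def)
      finally have "w = 64 * K ^ 6" by (simp add: power_mult_distrib)
      moreover have "K \<le> K ^ 6" using K by (simp add: self_le_power)
      ultimately show ?thesis using K by linarith
    qed
    have lnN_G: "ln N \<le> 132 * L * G"
    proof -
      have "ln N / 4 \<le> (\<Prod>p | prime p \<and> real p \<le> w. real p / (real p - 1)) * G"
        using ln_le_prod_times_sieve_sum[OF z, of w] by (simp add: lnz P_def G_def)
      also have "\<dots> \<le> 33 * L * G"
        unfolding w_def using mertens_product_at_power_le[OF L] G1 by (intro mult_right_mono) auto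
      finally show ?thesis by simp
    qed
    have large: "G * (\<Sum>p\<in>T. S p) \<le> 21 / 10 * (M * F2)"
    proof -
      have "G * (\<Sum>p\<in>T. S p) \<le> (real (n + J) + 5 / (6 * real J * \<delta>\<^sup>2)) * F2
          + 3 / (w - 1) * (2 * real (n + J) + 5 * z ^ 8 / (6 * real J)) * F1\<^sup>2"
        unfolding S_def F1_def F2_def G_def
      proof (rule sieved_large_sieve[OF B \<delta> _ J(1)])
        show "T \<subseteq> {..n}" using upto by (auto simp: T_def)
        show "\<not> p dvd q" if "q \<in> T" "p \<in> P" for q p
        proof
          assume "p dvd q"
          then have "p = q" using that by (auto simp: T_def P_def dest: primes_dvd_imp_eq)
          then show False using that by (auto simp: T_def P_def)
        qed
        show "w - 1 > 0" using w K by linarith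
      qed (auto simp: P_def)
      also have "\<dots> \<le> 15 / 8 * M * F2 + 3 / (63 * K) * (37 / 8 * M) * F1\<^sup>2"
        using J(2,3) w K M_pos F2 unfolding z8
        by (intro add_mono mult_mono mult_right_mono frac_le) (auto simp: mult_nonneg_nonneg)
      also have "\<dots> = (15 / 8 + 111 / 504) * (M * F2)"
        unfolding F1 using K by (simp add: field_simps)
      also have "\<dots> \<le> 21 / 10 * (M * F2)" using MF by (intro mult_right_mono) auto
      finally show ?thesis .
    qed
    have T: "(\<Sum>p\<in>T. S p) \<le> 278 * L / ln N * (M * F2)"
    proof -
      have "(\<Sum>p\<in>T. S p) * ln N \<le> (\<Sum>p\<in>T. S p) * (132 * L * G)"
        using lnN_G by (intro mult_left_mono sum_nonneg) (auto simp: S_def)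
      also have "\<dots> = 132 * L * (G * (\<Sum>p\<in>T. S p))" by simp
      also have "\<dots> \<le> 132 * L * (21 / 10 * (M * F2))"
        using large L23 by (intro mult_left_mono) auto
      also have "\<dots> = 1386 / 5 * (L * (M * F2))" by simp
      also have "\<dots> \<le> 278 * (L * (M * F2))"
        using L23 M_pos F2 by (intro mult_right_mono mult_nonneg_nonneg) auto
      finally show ?thesis using lnN by (simp add: field_simps)
    qed
    have small: "(\<Sum>p | prime p \<and> real p \<le> z. S p) \<le> 2 * L / ln N * (M * F2)"
    proof -
      have "(\<Sum>p | prime p \<and> real p \<le> z. S p) \<le> (\<Sum>p | prime p \<and> real p \<le> z. F1\<^sup>2)"
      proof (rule sum_mono)
        fix p
        have "norm (\<Sum>b\<in>B. f b * ee (of_nat p * u b)) \<le> F1"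
          unfolding F1_def by (rule order.trans[OF norm_sum]) (simp add: norm_mult)
        then show "S p \<le> F1\<^sup>2" unfolding S_def by (intro power_mono) auto
      qed
      also have "\<dots> = real (card {p. prime p \<and> real p \<le> z}) * F1\<^sup>2" by simp
      also have "\<dots> \<le> z * F1\<^sup>2"
      proof (rule mult_right_mono)
        have "{p. prime p \<and> real p \<le> z} \<subseteq> {1..nat \<lfloor>z\<rfloor>}"
          by (auto simp: le_nat_floor Suc_le_eq prime_gt_0_nat)
        then have "card {p. prime p \<and> real p \<le> z} \<le> nat \<lfloor>z\<rfloor>"
          using card_mono[of "{1..nat \<lfloor>z\<rfloor>}"] by fastforce
        then show "real (card {p. prime p \<and> real p \<le> z}) \<le> z" using z by linarith
      qed simp
      also have "\<dots> = z * K * F2" by (simp add: F1)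
      also have "\<dots> \<le> 2 * L / ln N * (M * F2)"
      proof -
        have "2 * K \<le> z"
        proof -
          have "L \<le> ln z" using big L23 by (simp add: lnz)
          then show ?thesis using K z by (simp add: L_def)
        qed
        then have "z * K \<le> z * (z / 2)" using z by (intro mult_left_mono) auto
        also have "\<dots> = sqrt N / 2" using z2 by (simp add: power2_eq_square)
        finally have zK: "z * K \<le> sqrt N / 2" .
        have "ln N = 2 * ln (sqrt N)" using N by (simp add: ln_sqrt)
        also have "\<dots> \<le> 2 * sqrt N" using N by (simp add: ln_bound)
        finally have "z * K * ln N \<le> (sqrt N / 2) * (2 * sqrt N)"
          using zK lnN N by (intro mult_mono) auto
        also have "\<dots> = N" using N by simp
        also have "\<dots> \<le> 2 * L * M"
        proof -
          have "1 * M \<le> 2 * L * M" using L23 M_pos by (intro mult_right_mono) auto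
          then show ?thesis using M by linarith
        qed
        finally have "z * K \<le> 2 * L * M / ln N" using lnN by (simp add: field_simps)
        then have "z * K * F2 \<le> 2 * L * M / ln N * F2" using F2 by (intro mult_right_mono) auto
        then show ?thesis by (simp add: mult_ac)
      qed
      finally show ?thesis .
    qed
    have zN: "z \<le> N"
    proof -
      have "z \<le> N powr 1" unfolding z_def using N by (intro powr_mono) auto
      then show ?thesis using N by simp
    qed
    have "{p. prime p \<and> real p \<le> N} = {p. prime p \<and> real p \<le> z} \<union> T"
      using zN by (auto simp: T_def)
    moreover have "finite T" unfolding T_def by (rule finite_subset[OF _ finite_primes_le[of N]]) auto
    moreover have "{p. prime p \<and> real p \<le> z} \<inter> T = {}" by (auto simp: T_def)
    ultimately have "(\<Sum>p | prime p \<and> real p \<le> N. S p)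
        = (\<Sum>p | prime p \<and> real p \<le> z. S p) + (\<Sum>p\<in>T. S p)"
      by (simp only: sum.union_disjoint finite_primes_le)
    also have "\<dots> \<le> 2 * L / ln N * (M * F2) + 278 * L / ln N * (M * F2)"
      using small T by (rule add_mono)
    also have "\<dots> = 280 * M * F2 * (L / ln N)" using lnN by (simp add: field_simps)
    finally show ?thesis .
  qed
  then show ?thesis by (simp add: S_def M_def L_def K_def)
qed

section \<open>Sums over the circle\<close>

lemma e_mult_rep: "e_mult b p = ee (of_nat p * rep_real_mod_int b)"
proof -
  have "e_mult b p = e_mult (real_mod_int (rep_real_mod_int b)) p"
    by (simp add: Quotient3_abs_rep[OF Quotient3_real_mod_int])
  then show ?thesis by (simp add: e_mult.abs_eq mult.commute)
qed

lemma circle_dist_rep: "circle_dist b c = int_dist (rep_real_mod_int b - rep_real_mod_int c)"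
proof -
  have "circle_dist b c
      = circle_dist (real_mod_int (rep_real_mod_int b)) (real_mod_int (rep_real_mod_int c))"
    by (simp add: Quotient3_abs_rep[OF Quotient3_real_mod_int])
  then show ?thesis by (simp add: circle_dist.abs_eq)
qed

lemma lnorm_1: "lnorm 1 B f = (\<Sum>b\<in>B. norm (f b))"
  by (simp add: lnorm_def sum_nonneg)

lemma lnorm_2_squared: "(lnorm 2 B f)\<^sup>2 = (\<Sum>b\<in>B. (norm (f b))\<^sup>2)"
  by (simp add: lnorm_def powr_half_sqrt sum_nonneg)

theorem theorem5p1:
  fixes N \<delta> :: real and B :: "real_mod_int set" and f :: "real_mod_int \<Rightarrow> complex"
  assumes "N \<ge> 1000"
    and "\<delta> > 0"
    and "well_spaced \<delta> B"
    and "\<exists>b\<in>B. f b \<noteq> 0"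
  shows "(\<Sum>p | prime p \<and> real p \<le> N. (norm (\<Sum>b\<in>B. f b * e_mult b p))\<^sup>2)
    \<le> 280 * (N + inverse \<delta>) * (lnorm 2 B f)\<^sup>2
        * (ln (2 * (lnorm 1 B f)\<^sup>2 / (lnorm 2 B f)\<^sup>2) / ln N)"
proof -
  have fin: "finite B" using assms(2,3) by (rule well_spaced_finite)
  have "spaced \<delta> B rep_real_mod_int"
    using assms(3) by (simp add: spaced_def well_spaced_def circle_dist_rep)
  moreover have "(\<Sum>b\<in>B. (norm (f b))\<^sup>2) > 0"
    using assms(4) fin by (auto intro: sum_pos2)
  ultimately show ?thesis
    unfolding lnorm_1 lnorm_2_squared e_mult_rep
    by (rule sum_primes_exponential_square_le[OF assms(1,2) fin])
qed

end
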